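(* Let $K$ be a number field and $\mathfrak{p}$ a nonzero prime ideal of $\mathcal{O}_K$. The arithmetic partial derivative $D_{K,\mathfrak{p}}$ is not strictly differentiable (with respect to the ultrametric absolute value $|\cdot|_{\nu_{\mathfrak{p}}}$) at $0$.
   Context: For a nonzero prime ideal $\mathfrak{q}$ of the ring of integers of a number field lying over the rational prime $q$, $\nu_{\mathfrak{q}}$ denotes the associated discrete valuation normalized to extend $\nu_q$, and for a finite Galois extension $L/\mathbb{Q}$, $g(q,L)$ is the number of prime ideals of $\mathcal{O}_L$ over $q$. For $L/\mathbb{Q}$ finite Galois and a set $T'$ of nonzero prime ideals of $\mathcal{O}_L$, $D_{L,T'}(0)=0$ and $D_{L,T'}(x) := x\sum_{\mathfrak{Q}\in T'} \frac{\nu_{\mathfrak{Q}}(x)}{q\,g(q,L)}$ for $x\ne 0$ ($q$ the prime below $\mathfrak{Q}$). For a number field $K$ and a set $T$ of prime ideals of $\mathcal{O}_K$, choose a finite extension $L/K$ with $L/\mathbb{Q}$ Galois, let $T_{L/K}$ be the prime ideals of $\mathcal{O}_L$ lying over elements of $T$, and set $D_{K,T}(x) := D_{L,T_{L/K}}(x)$ (independent of $L$); $D_{K,\mathfrak{p}} := D_{K,\{\mathfrak{p}\}}$. $|x|_{\nu_{\mathfrak{p}}} = c^{\nu_{\mathfrak{p}}(x)}$ for a fixed $0<c<1$. A function $f:K\to K$ is strictly differentiable at $x$ if $\frac{f(u)-f(v)}{u-v}$ has a limit as $(u,v) \to (x,x)$ with $u \neq v$. *)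

theory Defs
  imports
    Complex_Main
    "HOL-Algebra.Algebraic_Closure_Type"
    "HOL-Algebra.Ideal_Product"
begin

text \<open>
  Number fields are subfields of an arbitrary algebraically closed field of characteristic 0,
  given by a type. Any abstract number field arises in this way: embed it into its
  algebraic closure.
\<close>

definition number_field :: "'a::field_char_0 set \<Rightarrow> bool" where
  "number_field K \<longleftrightarrow>
     subfield K ring_of_type_algebra \<and> ring.finite_dimension ring_of_type_algebra \<rat> K"

definition ring_of_integers :: "'a::field_char_0 set \<Rightarrow> 'a ring" where
  "ring_of_integers K = ring_of_type_algebra\<lparr>carrier := {x \<in> K. algebraic_int x}\<rparr>"

text \<open>Normality and separability are expressed together: an irreducible rational polynomial
  with a root in \<open>L\<close> is a product of distinct linear factors over \<open>L\<close>.\<close>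

definition galois_over_rat :: "'a::field_char_0 set \<Rightarrow> bool" where
  "galois_over_rat L \<longleftrightarrow> number_field L \<and>
     (\<forall>f :: rat poly. irreducible f \<and> (\<exists>x\<in>L. poly (map_poly of_rat f) x = 0) \<longrightarrow>
        (\<exists>S. finite S \<and> S \<subseteq> L \<and>
             map_poly of_rat f = smult (of_rat (lead_coeff f)) (\<Prod>a\<in>S. [:-a, 1:])))"

definition nonzero_primes :: "'a::field_char_0 set \<Rightarrow> 'a set set" where
  "nonzero_primes K = {Q. primeideal Q (ring_of_integers K) \<and> Q \<noteq> {0}}"

definition lies_over_rat_prime :: "'a::field_char_0 set \<Rightarrow> nat \<Rightarrow> bool" where
  "lies_over_rat_prime Q q \<longleftrightarrow> prime q \<and> {n::int. of_int n \<in> Q} = {n. int q dvd n}"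

definition prime_below :: "'a::field_char_0 set \<Rightarrow> nat" where
  "prime_below Q = (THE q. lies_over_rat_prime Q q)"

definition num_primes_over :: "nat \<Rightarrow> 'a::field_char_0 set \<Rightarrow> nat" where
  "num_primes_over q L = card {Q \<in> nonzero_primes L. lies_over_rat_prime Q q}"

definition ord_integral :: "'a::field_char_0 set \<Rightarrow> 'a set \<Rightarrow> 'a \<Rightarrow> nat" where
  "ord_integral K Q a = (GREATEST n. a \<in> Q [^]\<^bsub>ideals_set (ring_of_integers K)\<^esub> n)"

definition ord_prime :: "'a::field_char_0 set \<Rightarrow> 'a set \<Rightarrow> 'a \<Rightarrow> int" where
  "ord_prime K Q x = (THE k. \<exists>a b. a \<in> carrier (ring_of_integers K) - {0} \<and>
      b \<in> carrier (ring_of_integers K) - {0} \<and> x = a / b \<and>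
      k = int (ord_integral K Q a) - int (ord_integral K Q b))"

text \<open>The divisor is the ramification index of \<open>Q\<close>, so that \<open>valuation K Q\<close> extends the
  \<open>q\<close>-adic valuation of the rationals. The values are meaningful only for nonzero \<open>x\<close>.\<close>

definition valuation :: "'a::field_char_0 set \<Rightarrow> 'a set \<Rightarrow> 'a \<Rightarrow> rat" where
  "valuation K Q x = of_int (ord_prime K Q x) / of_int (ord_prime K Q (of_nat (prime_below Q)))"

text \<open>For nonzero \<open>x\<close> only finitely many summands are nonzero, even if \<open>T\<close> is infinite;
  restricting the index set makes the finite sum operator agree with this sum.\<close>

definition arith_deriv_galois :: "'a::field_char_0 set \<Rightarrow> 'a set set \<Rightarrow> 'a \<Rightarrow> 'a" where
  "arith_deriv_galois L T x = (if x = 0 then 0 else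
     x * of_rat (\<Sum>Q | Q \<in> T \<and> valuation L Q x \<noteq> 0.
       valuation L Q x / (of_nat (prime_below Q) * of_nat (num_primes_over (prime_below Q) L))))"

definition primes_lying_over ::
    "'a::field_char_0 set \<Rightarrow> 'a set \<Rightarrow> 'a set set \<Rightarrow> 'a set set" where
  "primes_lying_over L K T =
     {Q \<in> nonzero_primes L. Q \<inter> carrier (ring_of_integers K) \<in> T}"

definition galois_extension_of ::
    "'a::{alg_closed_field, field_char_0} set \<Rightarrow> 'a set" where
  "galois_extension_of K = (SOME L. K \<subseteq> L \<and> galois_over_rat L)"

definition arith_deriv ::
    "'a::{alg_closed_field, field_char_0} set \<Rightarrow> 'a set set \<Rightarrow> 'a \<Rightarrow> 'a" where
  "arith_deriv K T x =
     arith_deriv_galois (galois_extension_of K) (primes_lying_over (galois_extension_of K) K T) x"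

definition prime_abs :: "real \<Rightarrow> 'a::field_char_0 set \<Rightarrow> 'a set \<Rightarrow> 'a \<Rightarrow> real" where
  "prime_abs c K P x = (if x = 0 then 0 else c powr of_rat (valuation K P x))"

definition strictly_differentiable_at ::
    "'a::field set \<Rightarrow> ('a \<Rightarrow> real) \<Rightarrow> ('a \<Rightarrow> 'a) \<Rightarrow> 'a \<Rightarrow> bool" where
  "strictly_differentiable_at K N f x \<longleftrightarrow>
     (\<exists>l\<in>K. \<forall>\<epsilon>>0. \<exists>\<delta>>0. \<forall>u\<in>K. \<forall>v\<in>K.
        u \<noteq> v \<and> N (u - x) < \<delta> \<and> N (v - x) < \<delta> \<longrightarrow>
        N ((f u - f v) / (u - v) - l) < \<epsilon>)"

end

theory Submission
  imports Defs "Jordan_Normal_Form.Char_Poly"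
begin

text \<open>
  Let \<open>p\<close> be the rational prime below \<open>P\<close>. Every prime of \<open>L\<close> above \<open>P\<close> has valuation \<open>k\<close> at
  \<open>p ^ k\<close>, so the derivative of \<open>p ^ k\<close> divided by \<open>p ^ k\<close> is \<open>k * C\<close> for a fixed nonzero rational
  \<open>C\<close>. Since \<open>p ^ k\<close> tends to \<open>0\<close>, a derivative at \<open>0\<close> would be the limit of \<open>k * C\<close>, and the
  ultrametric inequality would make consecutive differences, all equal to \<open>C\<close>, arbitrarily small.

  The valuations are additive because every nonzero prime \<open>Q\<close> admits an element \<open>\<gamma>\<close> of the field
  with \<open>Q ^ n = {x. \<gamma> ^ n * x is integral}\<close>: choose \<open>\<gamma> = b / p\<close> where \<open>Q\<close> is the annihilator
  of \<open>b\<close> modulo \<open>p\<close>. That the ring of integers has finite quotients supplies \<open>b\<close>, and also shows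
  that an element all of whose powers have a common denominator is integral.
\<close>

section \<open>Algebraic integers\<close>

text \<open>The definitions dictate most of the work. \<open>ord_integral\<close> is a greatest
  exponent over ideal powers, and \<open>galois_extension_of\<close> is an arbitrary choice, so the
  order must be shown additive and a Galois closure must be shown to exist before any derivative can
  be computed. Maximal ideals and maximal annihilators come from the fact that only finitely many
  ideals contain a given positive integer. Contradictions about \<open>Q\<close> end in the same
  way: \<open>\<gamma>\<close> would be integral, which would put \<open>1\<close> into
  \<open>Q\<close>. The constant \<open>C\<close> is \<open>r / (p * g)\<close>, where
  \<open>r\<close> counts the primes of \<open>L\<close> above \<open>P\<close> and \<open>g\<close>
  those above \<open>p\<close>. It is nonzero because at least one prime of \<open>L\<close> lies
  above \<open>P\<close>; this is where lying over enters. The difference quotients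
  \<open>k * C\<close> stay bounded in the absolute value, so the derivative fails to exist by
  oscillation and not by growth: consecutive integers differ by \<open>1\<close>, whose absolute
  value is \<open>1\<close>.\<close>

interpretation int_span: Modules.module "\<lambda>(n::int) (x::'a::field_char_0). of_int n * x"
  by unfold_locales (simp_all add: algebra_simps)

text \<open>Determinant trick: multiplication by \<open>z\<close> acts on the vector of elements of
  \<open>B\<close> through an integer matrix. This vector is an eigenvector for \<open>z\<close>,
  nonzero because \<open>1\<close> is one of its entries, so \<open>z\<close> is a root of the monic
  integer characteristic polynomial.\<close>

lemma algebraic_int_if_finite_stable:
  fixes z :: "'a::field_char_0"
  assumes B: "finite B" "1 \<in> B" and z: "\<And>b. b \<in> B \<Longrightarrow> z * b \<in> int_span.span B"
  shows "algebraic_int z"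
proof -
  obtain f n where f: "bij_betw f {..<n::nat} B"
    using ex_bij_betw_nat_finite[OF B(1)] by (metis atLeast0LessThan)
  have "\<exists>c. z * b = (\<Sum>b'\<in>B. of_int (c b') * b')" if "b \<in> B" for b
    using z[OF that] unfolding int_span.span_finite[OF B(1)] by auto
  then obtain c where c: "\<And>b. b \<in> B \<Longrightarrow> z * b = (\<Sum>b'\<in>B. of_int (c b b') * b')"
    by metis
  define A :: "int mat" where "A = Matrix.mat n n (\<lambda>(i, j). c (f i) (f j))"
  define v where "v = Matrix.vec n f"
  have A: "A \<in> carrier_mat n n" by (simp add: A_def)
  have A': "map_mat of_int A \<in> carrier_mat n n" by (simp add: A_def)
  have v: "v \<in> carrier_vec n" by (simp add: v_def)
  obtain i where i: "i < n" "f i = 1"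
    using B(2) f by (auto simp: bij_betw_def)
  have "map_mat of_int A *\<^sub>v v = z \<cdot>\<^sub>v v"
  proof (rule eq_vecI)
    fix k assume "k < dim_vec (z \<cdot>\<^sub>v v)"
    then have k: "k < n" by (simp add: v_def)
    have "(map_mat of_int A *\<^sub>v v) $ k = (\<Sum>j<n. of_int (c (f k) (f j)) * f j)"
      using k by (simp add: A_def v_def scalar_prod_def atLeast0LessThan)
    also have "\<dots> = (\<Sum>b'\<in>B. of_int (c (f k) b') * b')"
      by (rule sum.reindex_bij_betw[OF f])
    also have "\<dots> = z * f k"
      using c[of "f k"] f k by (auto simp: bij_betw_def)
    finally show "(map_mat of_int A *\<^sub>v v) $ k = (z \<cdot>\<^sub>v v) $ k"
      using k by (simp add: v_def)
  qed (simp add: A_def v_def)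
  moreover have "v \<noteq> 0\<^sub>v n"
  proof
    assume "v = 0\<^sub>v n"
    then have "v $ i = 0" using i by simp
    then show False using i by (simp add: v_def)
  qed
  ultimately have "eigenvalue (map_mat of_int A) z"
    using v A' unfolding eigenvalue_def eigenvector_def by auto
  then have "poly (char_poly (map_mat of_int A)) z = 0"
    using eigenvalue_root_char_poly[OF A'] by blast
  then have "poly (map_poly of_int (char_poly A)) z = 0"
    by (simp add: of_int_hom.char_poly_hom[OF A])
  moreover have "lead_coeff (char_poly A) = 1"
    using degree_monic_char_poly[OF A] by simp
  ultimately show ?thesis
    unfolding algebraic_int_altdef_ipoly by blast
qed

lemma algebraic_int_reduce:
  fixes x :: "'a::field_char_0"
  assumes "algebraic_int x"
  obtains n c where "n > 0" "x ^ n = (\<Sum>i<n. of_int (c i) * x ^ i)"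
proof -
  obtain p where p: "poly (map_poly of_int p) x = 0" "lead_coeff p = 1"
    using assms unfolding algebraic_int_altdef_ipoly by blast
  define n where "n = degree p"
  have "0 = (\<Sum>i\<le>n. of_int (coeff p i) * x ^ i)"
    using p(1) by (simp add: poly_altdef n_def coeff_map_poly)
  also have "\<dots> = (\<Sum>i<n. of_int (coeff p i) * x ^ i) + x ^ n"
    using p(2) by (simp add: lessThan_Suc_atMost[symmetric] n_def)
  finally have "x ^ n = - (\<Sum>i<n. of_int (coeff p i) * x ^ i)"
    by (metis add.commute eq_neg_iff_add_eq_0)
  also have "\<dots> = (\<Sum>i<n. of_int (- coeff p i) * x ^ i)"
    by (simp add: sum_negf)
  finally have "x ^ n = (\<Sum>i<n. of_int (- coeff p i) * x ^ i)" .
  moreover from this have "n > 0"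
    by (intro gr0I) simp
  ultimately show thesis by (intro that)
qed

text \<open>The monomials \<open>x ^ i * y ^ j\<close> below the two degrees span a group that
  multiplication by \<open>x\<close> and by \<open>y\<close> maps into itself, hence also
  multiplication by \<open>x + y\<close> and \<open>x * y\<close>.\<close>

lemma
  fixes x y :: "'a::field_char_0"
  assumes "algebraic_int x" "algebraic_int y"
  shows algebraic_int_add: "algebraic_int (x + y)"
    and algebraic_int_mult: "algebraic_int (x * y)"
proof -
  obtain m c where m: "m > 0" "x ^ m = (\<Sum>i<m. of_int (c i) * x ^ i)"
    using algebraic_int_reduce[OF assms(1)] .
  obtain n d where n: "n > 0" "y ^ n = (\<Sum>i<n. of_int (d i) * y ^ i)"
    using algebraic_int_reduce[OF assms(2)] .
  define B where "B = (\<lambda>(i, j). x ^ i * y ^ j) ` ({..<m} \<times> {..<n})"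
  have B: "finite B" by (simp add: B_def)
  have base: "x ^ i * y ^ j \<in> int_span.span B" if "i < m" "j < n" for i j
    by (rule int_span.span_base) (use that in \<open>auto simp: B_def\<close>)
  have one: "1 \<in> B"
    unfolding B_def using m(1) n(1) by (intro image_eqI[of _ _ "(0, 0)"]) auto
  have x: "x * b \<in> int_span.span B" if "b \<in> int_span.span B" for b
    using that
  proof (induction rule: int_span.span_induct_alt)
    case (step k b s)
    then obtain i j where b: "b = x ^ i * y ^ j" "i < m" "j < n" by (auto simp: B_def)
    have "x * b \<in> int_span.span B"
    proof (cases "Suc i < m")
      case True
      then show ?thesis using base[of "Suc i" j] b by (simp add: mult.assoc)
    next
      case False
      \<comment> \<open>Only the top exponent leaves the range of monomials; the monic relation for
        \<open>x\<close> brings it back.\<close>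
      then have "m = Suc i" using b by simp
      then have "x * b = x ^ m * y ^ j" by (simp add: b)
      also have "\<dots> = (\<Sum>i<m. of_int (c i) * (x ^ i * y ^ j))"
        by (simp add: m(2) sum_distrib_right mult.assoc)
      also have "\<dots> \<in> int_span.span B"
        using b(3) by (intro int_span.span_sum int_span.span_scale base) auto
      finally show ?thesis .
    qed
    then have "of_int k * (x * b) + x * s \<in> int_span.span B"
      using step by (intro int_span.span_add int_span.span_scale)
    then show ?case by (simp add: algebra_simps)
  qed (simp add: int_span.span_zero)
  have y: "y * b \<in> int_span.span B" if "b \<in> int_span.span B" for b
    using that
  proof (induction rule: int_span.span_induct_alt)
    case (step k b s)
    then obtain i j where b: "b = x ^ i * y ^ j" "i < m" "j < n" by (auto simp: B_def)
    have "y * b \<in> int_span.span B"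
    proof (cases "Suc j < n")
      case True
      then show ?thesis using base[of i "Suc j"] b by (simp add: mult_ac)
    next
      case False
      then have "n = Suc j" using b by simp
      then have "y * b = x ^ i * y ^ n" by (simp add: b)
      also have "\<dots> = (\<Sum>j<n. of_int (d j) * (x ^ i * y ^ j))"
        by (simp add: n(2) sum_distrib_left mult_ac)
      also have "\<dots> \<in> int_span.span B"
        using b(2) by (intro int_span.span_sum int_span.span_scale base) auto
      finally show ?thesis .
    qed
    then have "of_int k * (y * b) + y * s \<in> int_span.span B"
      using step by (intro int_span.span_add int_span.span_scale)
    then show ?case by (simp add: algebra_simps)
  qed (simp add: int_span.span_zero)
  show "algebraic_int (x + y)"
    by (rule algebraic_int_if_finite_stable[OF B one])
      (simp add: distrib_right int_span.span_add int_span.span_base x y)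
  show "algebraic_int (x * y)"
    by (rule algebraic_int_if_finite_stable[OF B one])
      (simp add: mult.assoc int_span.span_base x y)
qed

lemma algebraic_int_diff:
  fixes x y :: "'a::field_char_0"
  shows "algebraic_int x \<Longrightarrow> algebraic_int y \<Longrightarrow> algebraic_int (x - y)"
  using algebraic_int_add[of x "- y"] by simp

lemma algebraic_int_power:
  fixes x :: "'a::field_char_0"
  shows "algebraic_int x \<Longrightarrow> algebraic_int (x ^ n)"
  by (induction n) (auto intro: algebraic_int_mult)

lemma algebraic_imp_int_multiple:
  fixes x :: "'a::field_char_0"
  assumes "algebraic x"
  obtains N :: int where "N \<noteq> 0" "algebraic_int (of_int N * x)"
proof -
  obtain p where p: "p \<noteq> 0" "poly (map_poly of_int p) x = 0"
    using assms by (erule algebraicE')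
  define n where "n = degree p"
  define N where "N = lead_coeff p"
  have N: "N \<noteq> 0" using p(1) by (simp add: N_def)
  have n: "n > 0"
  proof (rule gr0I)
    assume "n = 0"
    then obtain a where "p = [:a:]" by (auto simp: n_def elim: degree_eq_zeroE)
    then show False using p by (simp add: map_poly_pCons)
  qed
  \<comment> \<open>Monic transform of \<open>p\<close>: with \<open>N\<close> its leading
    coefficient, \<open>q\<close> evaluated at \<open>N * x\<close> is \<open>N ^ (n - 1)\<close>
    times \<open>p\<close> evaluated at \<open>x\<close>.\<close>
  define q where "q = monom 1 n + (\<Sum>i<n. monom (coeff p i * N ^ (n - 1 - i)) i)"
  have cq: "coeff q i = (if i = n then 1 else if i < n then coeff p i * N ^ (n - 1 - i) else 0)" for i
    by (auto simp: q_def coeff_sum)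
  have dq: "degree q = n"
    by (rule antisym) (auto simp: cq intro!: degree_le le_degree)
  have "poly (map_poly of_int q) (of_int N * x) = (\<Sum>i\<le>n. of_int (coeff q i) * (of_int N * x) ^ i)"
    by (simp add: poly_altdef dq coeff_map_poly)
  also have "\<dots> = (\<Sum>i\<le>n. of_int (N ^ (n - 1)) * (of_int (coeff p i) * x ^ i))"
  proof (rule sum.cong[OF refl])
    fix i assume "i \<in> {..n}"
    then consider "i = n" | "i < n" by force
    then show "of_int (coeff q i) * (of_int N * x) ^ i = of_int (N ^ (n - 1)) * (of_int (coeff p i) * x ^ i)"
    proof cases
      case 1
      have "(of_int N :: 'a) ^ n = of_int N ^ (n - 1) * of_int N"
        using n by (cases n) (auto simp: mult.commute)
      then show ?thesis using 1 by (simp add: cq power_mult_distrib N_def n_def)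
    next
      case 2
      then have "n - 1 = (n - 1 - i) + i" by simp
      then have "(of_int N :: 'a) ^ (n - 1) = of_int N ^ (n - 1 - i) * of_int N ^ i"
        by (metis power_add)
      then show ?thesis using 2 by (simp add: cq power_mult_distrib)
    qed
  qed
  also have "\<dots> = of_int (N ^ (n - 1)) * poly (map_poly of_int p) x"
    by (simp add: poly_altdef n_def coeff_map_poly sum_distrib_left)
  finally have "poly (map_poly of_int q) (of_int N * x) = 0"
    using p by simp
  then have "algebraic_int (of_int N * x)"
    unfolding algebraic_int_altdef_ipoly by (intro exI[of _ q]) (simp add: dq cq)
  with N show thesis using that by blast
qed

text \<open>Since \<open>x\<close> is nonzero, factors of the variable can be stripped from an
  annihilating polynomial until its constant term \<open>a\<close> is nonzero. The rest of the
  polynomial then gives a cofactor of \<open>x\<close> with product \<open>- a\<close>.\<close>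

lemma algebraic_divides_int:
  fixes x :: "'a::field_char_0"
  assumes "algebraic x" "x \<noteq> 0"
  obtains q N where "N \<noteq> 0" "x * poly (map_poly of_int q) x = of_int N"
proof -
  obtain p where p: "p \<noteq> 0" "poly (map_poly of_int p) x = 0"
    using assms by (elim algebraicE')
  have "\<exists>q N. N \<noteq> 0 \<and> x * poly (map_poly of_int q) x = of_int N"
    using p
  proof (induction "degree p" arbitrary: p rule: less_induct)
    case less
    obtain a r where ar: "p = pCons a r" by (cases p)
    show ?case
    proof (cases "a = 0")
      case True
      then have r: "r \<noteq> 0" "degree r < degree p" using less.prems ar by auto
      have "poly (map_poly of_int r) x = 0"
        using less.prems assms(2) True ar by (simp add: map_poly_pCons)
      then show ?thesis using less.hyps r by blast
    next
      case False
      have "x * poly (map_poly of_int r) x = of_int (- a)"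
        using less.prems ar by (simp add: map_poly_pCons eq_neg_iff_add_eq_0 add.commute)
      then show ?thesis using False by (metis neg_equal_0_iff_equal)
    qed
  qed
  then show thesis using that by blast
qed

section \<open>Number fields and their rings of integers\<close>

interpretation rat_span: vector_space "\<lambda>(q::rat) (x::'a::field_char_0). of_rat q * x"
  by unfold_locales (simp_all add: algebra_simps of_rat_add of_rat_mult)

text \<open>The rewrites let facts about the ring record be used directly with the operations of the
  type.\<close>

interpretation type_field: domain "ring_of_type_algebra :: 'a::field_char_0 ring"
  rewrites "carrier (ring_of_type_algebra :: 'a ring) = UNIV"
    and "monoid.mult (ring_of_type_algebra :: 'a ring) = (*)"
    and "one (ring_of_type_algebra :: 'a ring) = 1"
    and "zero (ring_of_type_algebra :: 'a ring) = 0"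
    and "add (ring_of_type_algebra :: 'a ring) = (+)"
  by (rule Ring.field.axioms(1)[OF field_from_type_algebra]) (auto simp: ring_of_type_algebra_def)

lemma type_ring_simps [simp]:
  "carrier (ring_of_type_algebra :: 'a::field_char_0 ring) = UNIV"
  "monoid.mult (ring_of_type_algebra :: 'a ring) = (*)"
  "one (ring_of_type_algebra :: 'a ring) = 1"
  "zero (ring_of_type_algebra :: 'a ring) = 0"
  "add (ring_of_type_algebra :: 'a ring) = (+)"
  by (auto simp: ring_of_type_algebra_def)

lemma a_inv_type_ring [simp]: "\<ominus>\<^bsub>ring_of_type_algebra\<^esub> x = - (x :: 'a::field_char_0)"
  by (rule type_field.minus_equality) auto

lemma m_inv_type_ring:
  assumes "x \<noteq> (0 :: 'a::field_char_0)"
  shows "inv\<^bsub>ring_of_type_algebra\<^esub> x = inverse x"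
  by (rule type_field.inv_char) (use assms in auto)

lemma subfield_Rats: "subfield (\<rat> :: 'a::field_char_0 set) ring_of_type_algebra"
  by (rule field.subfieldI'[OF field_from_type_algebra], rule type_field.subringI) (auto simp: m_inv_type_ring)

lemma subfield_closed:
  fixes K :: "'a::field_char_0 set"
  assumes sf: "subfield K ring_of_type_algebra"
  shows "0 \<in> K" "1 \<in> K"
    and "x \<in> K \<Longrightarrow> y \<in> K \<Longrightarrow> x + y \<in> K"
    and "x \<in> K \<Longrightarrow> y \<in> K \<Longrightarrow> x * y \<in> K"
    and "x \<in> K \<Longrightarrow> - x \<in> K"
    and "x \<in> K \<Longrightarrow> y \<in> K \<Longrightarrow> x - y \<in> K"
    and "x \<in> K \<Longrightarrow> inverse x \<in> K"
    and "x \<in> K \<Longrightarrow> y \<in> K \<Longrightarrow> x / y \<in> K"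
    and "x \<in> K \<Longrightarrow> x ^ n \<in> K"
    and "of_int m \<in> K" "of_nat k \<in> K" "of_rat r \<in> K"
proof -
  note sr = subringE[OF subfieldE(1)[OF sf], simplified]
  show "0 \<in> K" and 1: "1 \<in> K"
    and add: "x \<in> K \<Longrightarrow> y \<in> K \<Longrightarrow> x + y \<in> K"
    and mult: "x \<in> K \<Longrightarrow> y \<in> K \<Longrightarrow> x * y \<in> K"
    and minus: "x \<in> K \<Longrightarrow> - x \<in> K" for x y
    using sr by auto
  show "x \<in> K \<Longrightarrow> y \<in> K \<Longrightarrow> x - y \<in> K"
    using add[of x "- y"] minus[of y] by simp
  have inv: "inverse x \<in> K" if "x \<in> K" for x
  proof (cases "x = 0")
    case False
    then show ?thesis
      using type_field.subfield_m_inv(1)[OF sf, of x] that m_inv_type_ring[of x] by auto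
  qed (use that in auto)
  then show "x \<in> K \<Longrightarrow> inverse x \<in> K" .
  show div: "x \<in> K \<Longrightarrow> y \<in> K \<Longrightarrow> x / y \<in> K" for x y
    using mult inv by (simp add: divide_inverse)
  show "x \<in> K \<Longrightarrow> x ^ n \<in> K"
    by (induction n) (auto intro: 1 mult)
  show nat: "of_nat k \<in> K" for k
    by (induction k) (auto intro: add 1 sr(2))
  show int: "of_int m \<in> K" for m
    by (cases m) (auto intro: nat minus simp del: of_nat_Suc)
  obtain a b where "r = of_int a / of_int b"
    by (metis quotient_of_div surj_pair)
  then show "of_rat r \<in> K"
    using div[OF int[of a] int[of b]] by (simp add: of_rat_divide)
qed

lemma number_field_imp_subfield: "number_field K \<Longrightarrow> subfield K ring_of_type_algebra"
  by (simp add: number_field_def)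

lemmas number_field_closed = subfield_closed[OF number_field_imp_subfield]

text \<open>Passes from the list-based dimension of the definition to \<open>rat_span\<close>, where
  the size of an independent set is bounded by the size of a spanning set.\<close>

lemma number_field_finite_span:
  fixes K :: "'a::field_char_0 set"
  assumes "number_field K"
  obtains U where "finite U" "K \<subseteq> rat_span.span U"
proof -
  have fd: "type_field.finite_dimension \<rat> K"
    using assms by (auto simp: number_field_def)
  then obtain Us where Us: "type_field.Span \<rat> Us = K"
    using type_field.exists_base[OF subfield_Rats] by (metis type_field.finite_dimensionE')
  have "type_field.Span \<rat> Us \<subseteq> rat_span.span (set Us)" for Us :: "'a list"
  proof (induction Us)
    case (Cons u Us)
    show ?case
    proof
      fix x assume "x \<in> type_field.Span \<rat> (u # Us)"
      then obtain k v where k: "k \<in> \<rat>" "v \<in> type_field.Span \<rat> Us" "x = k * u + v"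
        by (auto simp: type_field.line_extension_mem_iff)
      then obtain q where q: "k = of_rat q" by (auto elim: Rats_cases)
      have "v \<in> rat_span.span (set (u # Us))"
        using k(2) Cons rat_span.span_mono[of "set Us" "set (u # Us)"] by auto
      then show "x \<in> rat_span.span (set (u # Us))"
        unfolding k(3) q
        by (intro rat_span.span_add rat_span.span_scale) (auto intro: rat_span.span_base)
    qed
  qed simp
  with Us show thesis using that[of "set Us"] by auto
qed

lemma rat_independent_card_le:
  fixes U :: "'a::field_char_0 set"
  assumes "finite U" "B \<subseteq> rat_span.span U" "rat_span.independent B"
  shows "finite B" "card B \<le> card U"
  using rat_span.independent_span_bound[of U B] assms by auto

text \<open>One more power of \<open>x\<close> than there are spanning elements must be linearly
  dependent. Coinciding powers are treated separately, since they would collapse in the set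
  \<open>B\<close>; there a difference of two monomials annihilates \<open>x\<close>.\<close>

lemma number_field_algebraic:
  fixes K :: "'a::field_char_0 set"
  assumes "number_field K" "x \<in> K"
  shows "algebraic x"
proof -
  obtain U where U: "finite U" "K \<subseteq> rat_span.span U"
    using number_field_finite_span[OF assms(1)] .
  define n where "n = card U"
  have "\<exists>p. p \<noteq> 0 \<and> (\<forall>i. coeff p i \<in> \<rat>) \<and> poly p x = 0"
  proof (cases "inj_on (\<lambda>i. x ^ i) {..n}")
    case False
    then obtain i j where ij: "i \<noteq> j" "x ^ i = x ^ j" by (auto simp: inj_on_def)
    define p where "p = Polynomial.monom (1::'a) i - Polynomial.monom 1 j"
    have "coeff p i = 1" using ij by (simp add: p_def)
    then have "p \<noteq> 0" by auto
    moreover have "poly p x = 0" using ij by (simp add: p_def poly_monom)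
    ultimately show ?thesis by (intro exI[of _ p]) (auto simp: p_def)
  next
    case True
    define B where "B = (\<lambda>i. x ^ i) ` {..n}"
    have "card B = Suc n" using True by (simp add: B_def card_image)
    moreover have "B \<subseteq> rat_span.span U"
      using U assms by (auto simp: B_def intro: number_field_closed)
    ultimately have "rat_span.dependent B"
      using rat_independent_card_le(2)[OF U(1), of B] by (auto simp: n_def)
    then obtain u where u: "\<exists>v\<in>B. u v \<noteq> 0" "(\<Sum>v\<in>B. of_rat (u v) * v) = 0"
      using rat_span.dependent_finite[of B] by (auto simp: B_def)
    then obtain k where k: "k \<le> n" "u (x ^ k) \<noteq> 0" by (auto simp: B_def)
    define p where "p = (\<Sum>i\<le>n. Polynomial.monom (of_rat (u (x ^ i)) :: 'a) i)"
    have cp: "coeff p i = (if i \<le> n then of_rat (u (x ^ i)) else 0)" for i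
      by (auto simp: p_def coeff_sum)
    have "poly p x = (\<Sum>i\<le>n. of_rat (u (x ^ i)) * x ^ i)"
      by (simp add: p_def poly_sum poly_monom)
    also have "\<dots> = 0"
      using u(2) by (simp add: B_def sum.reindex[OF True])
    finally have "poly p x = 0" .
    moreover have "p \<noteq> 0" using k cp[of k] by auto
    ultimately show ?thesis by (intro exI[of _ p]) (auto simp: cp)
  qed
  then show ?thesis by (auto simp: algebraic_altdef)
qed

definition integers :: "'a::field_char_0 set \<Rightarrow> 'a set"  (\<open>\<O>\<close>) where
  "\<O> K = {x \<in> K. algebraic_int x}"

lemma carrier_ring_of_integers [simp]: "carrier (ring_of_integers K) = \<O> K"
  and mult_ring_of_integers [simp]: "x \<otimes>\<^bsub>ring_of_integers K\<^esub> y = x * y"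
  and add_ring_of_integers [simp]: "x \<oplus>\<^bsub>ring_of_integers K\<^esub> y = x + y"
  and one_ring_of_integers [simp]: "\<one>\<^bsub>ring_of_integers K\<^esub> = 1"
  and zero_ring_of_integers [simp]: "\<zero>\<^bsub>ring_of_integers K\<^esub> = 0"
  by (auto simp: ring_of_integers_def integers_def)

lemma integers_closed:
  fixes K :: "'a::field_char_0 set"
  assumes "number_field K"
  shows "0 \<in> \<O> K" "1 \<in> \<O> K"
    and "x \<in> \<O> K \<Longrightarrow> y \<in> \<O> K \<Longrightarrow> x + y \<in> \<O> K"
    and "x \<in> \<O> K \<Longrightarrow> y \<in> \<O> K \<Longrightarrow> x * y \<in> \<O> K"
    and "x \<in> \<O> K \<Longrightarrow> - x \<in> \<O> K"
    and "x \<in> \<O> K \<Longrightarrow> y \<in> \<O> K \<Longrightarrow> x - y \<in> \<O> K"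
    and "x \<in> \<O> K \<Longrightarrow> x ^ n \<in> \<O> K"
    and "of_int m \<in> \<O> K" "of_nat k \<in> \<O> K"
  using number_field_closed[OF assms]
  by (auto simp: integers_def intro: algebraic_int_add algebraic_int_mult algebraic_int_diff algebraic_int_power)

lemma cring_ring_of_integers:
  fixes K :: "'a::field_char_0 set"
  assumes "number_field K"
  shows "cring (ring_of_integers K)"
proof (rule cringI)
  show "abelian_group (ring_of_integers K)"
  proof (rule abelian_groupI)
    fix x assume "x \<in> carrier (ring_of_integers K)"
    then show "\<exists>y\<in>carrier (ring_of_integers K). y \<oplus>\<^bsub>ring_of_integers K\<^esub> x = \<zero>\<^bsub>ring_of_integers K\<^esub>"
      using integers_closed(5)[OF assms] by (intro bexI[of _ "- x"]) auto
  qed (use integers_closed[OF assms] in \<open>auto simp: algebra_simps\<close>)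
  show "comm_monoid (ring_of_integers K)"
    by (rule comm_monoidI) (use integers_closed[OF assms] in \<open>auto simp: algebra_simps\<close>)
qed (auto simp: algebra_simps)

lemma integers_poly_closed:
  fixes K :: "'a::field_char_0 set"
  assumes "number_field K" "x \<in> \<O> K"
  shows "poly (map_poly of_int q) x \<in> \<O> K"
proof (induction q)
  case (pCons a q)
  then show ?case
    using integers_closed(3)[OF assms(1) integers_closed(8)[OF assms(1), of a]
        integers_closed(4)[OF assms pCons.IH]]
    by (simp add: map_poly_pCons)
qed (use integers_closed[OF assms(1)] in simp)

lemma integer_divides_int:
  fixes K :: "'a::field_char_0 set"
  assumes "number_field K" "x \<in> \<O> K" "x \<noteq> 0"
  obtains y N where "y \<in> \<O> K" "N \<noteq> 0" "x * y = of_int N"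
  using algebraic_divides_int[of x] integers_poly_closed[OF assms(1,2)] assms
  by (metis algebraic_int_imp_algebraic mem_Collect_eq integers_def)

lemma number_field_fraction:
  fixes K :: "'a::field_char_0 set"
  assumes "number_field K" "x \<in> K"
  obtains a N where "a \<in> \<O> K" "N \<noteq> 0" "x = a / of_int N"
proof -
  obtain N where N: "N \<noteq> 0" "algebraic_int (of_int N * x)"
    using algebraic_imp_int_multiple[OF number_field_algebraic[OF assms]] .
  then show thesis
    using that[of "of_int N * x" N] number_field_closed[OF assms(1)] assms(2)
    by (auto simp: integers_def)
qed

section \<open>Finiteness of the ring of integers modulo a positive integer\<close>

lemma common_denominator:
  fixes u :: "'b \<Rightarrow> rat"
  assumes "finite B"
  shows "\<exists>D::int. D \<noteq> 0 \<and> (\<forall>b\<in>B. \<exists>m. of_int D * u b = of_int m)"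
  using assms
proof (induction B rule: finite_induct)
  case empty
  show ?case by (intro exI[of _ 1]) simp
next
  case (insert x B)
  then obtain D where D: "D \<noteq> 0" "\<forall>b\<in>B. \<exists>m. of_int D * u b = of_int m" by blast
  obtain a d where ad: "u x = of_int a / of_int d" "d \<noteq> 0"
    by (metis Rat.of_int_def Fract_of_int_quotient quotient_of_denom_pos quotient_of_div
        less_irrefl surj_pair)
  show ?case
  proof (rule exI[of _ "D * d"], intro conjI ballI)
    fix b assume "b \<in> insert x B"
    then consider "b = x" | "b \<in> B" by auto
    then show "\<exists>m. of_int (D * d) * u b = of_int m"
    proof cases
      case 1
      then show ?thesis using ad by (intro exI[of _ "D * a"]) simp
    next
      case 2
      then obtain m where "of_int D * u b = of_int m" using D by blast
      then have "of_int d * (of_int D * u b) = of_int (d * m)" by simp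
      then have "of_int (D * d) * u b = of_int (d * m)" by (simp only: of_int_mult mult_ac)
      then show ?thesis by blast
    qed
  qed (use D ad in simp)
qed

lemma all_powers_dvd_imp_zero:
  fixes c p :: int
  assumes "p > 1" "\<And>k. p ^ k dvd c"
  shows "c = 0"
proof (rule ccontr)
  assume "c \<noteq> 0"
  have "p ^ nat \<bar>c\<bar> \<le> \<bar>c\<bar>"
    using assms(2)[of "nat \<bar>c\<bar>"] \<open>c \<noteq> 0\<close> by (intro zdvd_imp_le) auto
  moreover have "int (nat \<bar>c\<bar>) < int (2 ^ nat \<bar>c\<bar>)"
    by (simp only: of_nat_less_iff less_exp)
  moreover have "(2::int) ^ nat \<bar>c\<bar> \<le> p ^ nat \<bar>c\<bar>"
    using assms(1) by (intro power_mono) auto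
  ultimately show False by simp
qed

text \<open>\<open>good\<close> sets are those that are linearly independent modulo
  \<open>p\<close>. A largest one must also generate modulo \<open>p\<close>, so its combinations
  with coefficients in \<open>{0..<p}\<close> represent all residues.\<close>

lemma finite_residues_prime:
  fixes K :: "'a::field_char_0 set"
  assumes K: "number_field K" and p: "prime (p::nat)"
  shows "\<exists>S. finite S \<and> (\<forall>x\<in>\<O> K. \<exists>s\<in>S. \<exists>y\<in>\<O> K. x = s + of_nat p * y)"
proof -
  note cl = integers_closed[OF K]
  have sum_cl: "(\<Sum>b\<in>B. of_int (c b) * b) \<in> \<O> K" if "B \<subseteq> \<O> K" for B c
    using that by (induction B rule: infinite_finite_induct) (auto intro!: cl)
  obtain U where U: "finite U" "K \<subseteq> rat_span.span U"
    using number_field_finite_span[OF K] .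
  define good where "good = (\<lambda>B. finite B \<and> B \<subseteq> \<O> K \<and>
    (\<forall>c. (\<exists>y\<in>\<O> K. (\<Sum>b\<in>B. of_int (c b) * b) = of_nat p * y) \<longrightarrow> (\<forall>b\<in>B. int p dvd c b)))"
  have p0: "(of_nat p :: 'a) \<noteq> 0" using p by auto
  \<comment> \<open>Independence modulo \<open>p\<close> implies independence over the rationals, which bounds the
    number of elements.\<close>
  have card: "card B \<le> card U" if B: "good B" for B
  proof -
    have "rat_span.independent B"
    proof
      assume "rat_span.dependent B"
      then obtain u where u: "\<exists>v\<in>B. u v \<noteq> 0" "(\<Sum>v\<in>B. of_rat (u v) * v) = 0"
        using rat_span.dependent_finite[of B] B by (auto simp: good_def)
      obtain D where D: "D \<noteq> 0" "\<forall>b\<in>B. \<exists>m. of_int D * u b = of_int m"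
        using common_denominator[of B u] B by (auto simp: good_def)
      then obtain c where c: "\<And>b. b \<in> B \<Longrightarrow> of_int D * u b = of_int (c b)" by metis
      have "(\<Sum>b\<in>B. of_int (c b) * b) = (\<Sum>b\<in>B. of_rat (of_int D * u b) * b)"
        by (intro sum.cong) (auto simp: c)
      also have "\<dots> = of_int D * (\<Sum>v\<in>B. of_rat (u v) * v)"
        by (simp add: sum_distrib_left of_rat_mult mult.assoc)
      finally have c0: "(\<Sum>b\<in>B. of_int (c b) * b) = 0" using u by simp
      \<comment> \<open>Descent: in a vanishing integer relation all coefficients are divisible by
        \<open>p\<close>, and dividing by \<open>p\<close> leaves another vanishing
        relation.\<close>
      have dvd: "\<forall>b\<in>B. int p ^ k dvd c b" for k
      proof (induction k)
        case (Suc k)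
        define c' where "c' b = c b div int p ^ k" for b
        have c': "c b = int p ^ k * c' b" if "b \<in> B" for b
          using Suc that by (simp add: c'_def)
        have "of_nat p ^ k * (\<Sum>b\<in>B. of_int (c' b) * b) = (\<Sum>b\<in>B. of_int (c b) * b)"
          by (auto simp: sum_distrib_left c' mult.assoc intro!: sum.cong)
        then have "(\<Sum>b\<in>B. of_int (c' b) * b) = of_nat p * 0"
          using c0 p0 by simp
        then have "\<forall>b\<in>B. int p dvd c' b"
          using B cl(1) unfolding good_def by blast
        then show ?case
          using c' by (auto simp: mult.commute intro: mult_dvd_mono)
      qed simp
      have "c b = 0" if "b \<in> B" for b
        using all_powers_dvd_imp_zero[of "int p" "c b"] dvd that p prime_gt_1_nat[of p] by auto
      then show False using u(1) c D(1) by (metis mult_eq_0_iff of_int_0 of_int_eq_0_iff)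
    qed
    moreover have "B \<subseteq> rat_span.span U" using B U by (auto simp: good_def integers_def)
    ultimately show ?thesis using rat_independent_card_le[OF U(1)] by blast
  qed
  have "good {}" by (simp add: good_def)
  then have "\<exists>B. good B \<and> (\<forall>B'. good B' \<longrightarrow> card B' \<le> card B)"
    using card by (intro ex_has_greatest_nat[of good "{}" card "Suc (card U)"])
      (auto simp: less_Suc_eq_le)
  then obtain B where B: "good B" and max: "\<And>B'. good B' \<Longrightarrow> card B' \<le> card B"
    by auto
  then have finB: "finite B" and BO: "B \<subseteq> \<O> K" by (auto simp: good_def)
  have repr: "\<exists>c. \<exists>y\<in>\<O> K. x = (\<Sum>b\<in>B. of_int (c b) * b) + of_nat p * y" if x: "x \<in> \<O> K" for x
  proof (cases "x \<in> B")
    case True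
    have "(\<Sum>b\<in>B. of_int (if b = x then 1 else 0) * b) = (\<Sum>b\<in>B. if b = x then b else 0)"
      by (intro sum.cong) auto
    also have "\<dots> = x" using True finB by simp
    finally show ?thesis using cl(1) by (intro exI[of _ "\<lambda>b. if b = x then 1 else 0"] bexI[of _ 0]) auto
  next
    case False
    have "\<not> good (insert x B)"
      using max[of "insert x B"] False finB by auto
    then obtain c y where y: "y \<in> \<O> K" "(\<Sum>b\<in>insert x B. of_int (c b) * b) = of_nat p * y"
      and c: "\<exists>b\<in>insert x B. \<not> int p dvd c b"
      using finB BO x by (auto simp: good_def)
    have eq: "of_int (c x) * x + (\<Sum>b\<in>B. of_int (c b) * b) = of_nat p * y"
      using y(2) finB False by simp
    \<comment> \<open>Otherwise the term in \<open>x\<close> could be absorbed into the multiple of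
      \<open>p\<close>, leaving a relation modulo \<open>p\<close> among \<open>B\<close>
      alone.\<close>
    have "\<not> int p dvd c x"
    proof
      assume "int p dvd c x"
      then obtain k where k: "c x = int p * k" by auto
      have "(\<Sum>b\<in>B. of_int (c b) * b) = of_nat p * (y - of_int k * x)"
        using eq by (simp add: k algebra_simps)
      moreover have "y - of_int k * x \<in> \<O> K"
        by (intro cl) (use x y in auto)
      ultimately have "\<forall>b\<in>B. int p dvd c b" using B unfolding good_def by blast
      then show False using c \<open>int p dvd c x\<close> by auto
    qed
    then have "coprime (c x) (int p)"
      using p prime_imp_coprime[of "int p" "c x"] by (simp add: coprime_commute)
    \<comment> \<open>\<open>m\<close> inverts the coefficient of \<open>x\<close> modulo
      \<open>p\<close>; multiplying the relation by \<open>m\<close> solves it for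
      \<open>x\<close>.\<close>
    then obtain m k where mk: "m * c x + k * int p = 1"
      using bezout_int[of "c x" "int p"] by (auto simp: coprime_iff_gcd_eq_1)
    have "- of_int m * (\<Sum>b\<in>B. of_int (c b) * b) + of_nat p * (of_int m * y + of_int k * x)
        = of_int m * (of_nat p * y - (\<Sum>b\<in>B. of_int (c b) * b)) + of_nat p * (of_int k * x)"
      by (simp add: algebra_simps)
    also have "of_nat p * y - (\<Sum>b\<in>B. of_int (c b) * b) = of_int (c x) * x"
      by (simp flip: eq)
    also have "of_int m * (of_int (c x) * x) + of_nat p * (of_int k * x)
        = of_int (m * c x + k * int p) * x"
      by (simp add: algebra_simps)
    also have "\<dots> = x" by (simp only: mk of_int_1 mult_1)
    also have "- of_int m * (\<Sum>b\<in>B. of_int (c b) * b) = (\<Sum>b\<in>B. of_int (- m * c b) * b)"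
      by (simp only: sum_distrib_left of_int_mult of_int_minus mult.assoc)
    finally have "x = (\<Sum>b\<in>B. of_int (- m * c b) * b) + of_nat p * (of_int m * y + of_int k * x)"
      by (rule sym)
    moreover have "of_int m * y + of_int k * x \<in> \<O> K"
      by (intro cl x y)
    ultimately show ?thesis
      by (intro exI[of _ "\<lambda>b. - m * c b"] bexI[of _ "of_int m * y + of_int k * x"])
  qed
  define S where "S = (\<lambda>d. \<Sum>b\<in>B. of_int (d b) * b) ` (B \<rightarrow>\<^sub>E {0..<int p})"
  have "finite S" unfolding S_def using finB by (intro finite_imageI finite_PiE) auto
  moreover have "\<exists>s\<in>S. \<exists>y\<in>\<O> K. x = s + of_nat p * y" if x: "x \<in> \<O> K" for x
  proof -
    from repr[OF x] obtain c y where c: "y \<in> \<O> K"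
      "x = (\<Sum>b\<in>B. of_int (c b) * b) + of_nat p * y"
      by (elim exE bexE)
    define d where "d = restrict (\<lambda>b. c b mod int p) B"
    have "d \<in> B \<rightarrow>\<^sub>E {0..<int p}"
      using p prime_gt_0_nat[of p] by (auto simp: d_def)
    then have s: "(\<Sum>b\<in>B. of_int (d b) * b) \<in> S" by (auto simp: S_def)
    have "(\<Sum>b\<in>B. of_int (c b) * b) = (\<Sum>b\<in>B. of_int (d b + int p * (c b div int p)) * b)"
      by (intro sum.cong) (auto simp: d_def)
    also have "\<dots> = (\<Sum>b\<in>B. of_int (d b) * b) + of_nat p * (\<Sum>b\<in>B. of_int (c b div int p) * b)"
      by (simp add: sum.distrib sum_distrib_left algebra_simps)
    finally have "x = (\<Sum>b\<in>B. of_int (d b) * b) + of_nat p * ((\<Sum>b\<in>B. of_int (c b div int p) * b) + y)"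
      using c(2) by (simp add: algebra_simps)
    moreover have "(\<Sum>b\<in>B. of_int (c b div int p) * b) + y \<in> \<O> K"
      by (intro cl(3) sum_cl BO c)
    ultimately show ?thesis using s by (intro bexI)
  qed
  ultimately show ?thesis by (intro exI[of _ S] conjI ballI)
qed

text \<open>Induction on \<open>N\<close>, splitting off one prime factor: representatives modulo
  \<open>p * M\<close> are \<open>s + p * t\<close> with \<open>s\<close> taken modulo
  \<open>p\<close> and \<open>t\<close> modulo \<open>M\<close>.\<close>

lemma finite_residues:
  fixes K :: "'a::field_char_0 set"
  assumes K: "number_field K" and "N > 0"
  shows "\<exists>S. finite S \<and> (\<forall>x\<in>\<O> K. \<exists>s\<in>S. \<exists>y\<in>\<O> K. x = s + of_nat N * y)"
  using assms(2)
proof (induction N rule: less_induct)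
  case (less N)
  show ?case
  proof (cases "N = 1")
    case True
    then show ?thesis by (intro exI[of _ "{0}"]) auto
  next
    case False
    then obtain p where p: "prime p" "p dvd N" using prime_factor_nat by blast
    then obtain M where M: "N = p * M" by auto
    have M': "M < N" "M > 0" using less.prems p prime_gt_1_nat[of p] M by auto
    from less.IH[OF M'] obtain T where T: "finite T"
      "\<forall>x\<in>\<O> K. \<exists>s\<in>T. \<exists>y\<in>\<O> K. x = s + of_nat M * y"
      by (elim exE conjE)
    from finite_residues_prime[OF K p(1)] obtain S where S: "finite S"
      "\<forall>x\<in>\<O> K. \<exists>s\<in>S. \<exists>y\<in>\<O> K. x = s + of_nat p * y"
      by (elim exE conjE)
    have "\<exists>s\<in>(\<lambda>(s, t). s + of_nat p * t) ` (S \<times> T). \<exists>y\<in>\<O> K. x = s + of_nat N * y"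
      if x: "x \<in> \<O> K" for x
    proof -
      from bspec[OF S(2) x] obtain s y where s: "s \<in> S" "y \<in> \<O> K" "x = s + of_nat p * y"
        by (elim bexE)
      from bspec[OF T(2) s(2)] obtain t z where t: "t \<in> T" "z \<in> \<O> K" "y = t + of_nat M * z"
        by (elim bexE)
      have "x = (s + of_nat p * t) + of_nat N * z" using s t by (simp add: M algebra_simps)
      then show ?thesis using s t by (intro bexI[of _ "s + of_nat p * t"] bexI[of _ z]) auto
    qed
    then show ?thesis using S(1) T(1)
      by (intro exI[of _ "(\<lambda>(s, t). s + of_nat p * t) ` (S \<times> T)"]) auto
  qed
qed

text \<open>Pigeonhole on residue classes. Applied to powers of an element, it supplies the
  integrality criterion below, inverses modulo \<open>Q\<close>, and the annihilators that give
  \<open>\<gamma>\<close>.\<close>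

lemma residue_collision:
  fixes K :: "'a::field_char_0 set"
  assumes K: "number_field K" and "N > 0" and f: "\<And>n::nat. f n \<in> \<O> K"
  obtains i j y where "i < j" "y \<in> \<O> K" "f j - f i = of_nat N * y"
proof -
  obtain S where S: "finite S" "\<And>x. x \<in> \<O> K \<Longrightarrow> \<exists>s\<in>S. \<exists>y\<in>\<O> K. x = s + of_nat N * y"
    using finite_residues[OF assms(1,2)] by blast
  then have "\<forall>n. \<exists>s y. s \<in> S \<and> y \<in> \<O> K \<and> f n = s + of_nat N * y"
    using f by blast
  then obtain r y where r: "\<And>n. r n \<in> S" "\<And>n. y n \<in> \<O> K" "\<And>n. f n = r n + of_nat N * y n"
    by metis
  have "finite (range r)" using r(1) S(1) by (meson finite_subset image_subsetI)
  then have "\<not> inj r" using finite_imageD infinite_UNIV_nat by blast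
  then obtain i j where ij: "i \<noteq> j" "r i = r j" by (auto simp: inj_def)
  have "\<exists>i j. i < j \<and> r i = r j"
    using ij by (metis linorder_neqE_nat)
  then obtain i j where ij: "i < j" "r i = r j" by blast
  have "f j - f i = of_nat N * (y j - y i)" by (simp add: r(3) ij algebra_simps)
  moreover have "y j - y i \<in> \<O> K" by (intro integers_closed[OF K] r)
  ultimately show thesis using that ij by blast
qed

text \<open>Two of the multiples \<open>N * x ^ n\<close> agree modulo \<open>N\<close>, so
  \<open>x ^ j - x ^ i\<close> is an algebraic integer \<open>y\<close>. Thus \<open>x\<close>
  solves a monic equation with the integral right-hand side \<open>y\<close>.\<close>

lemma algebraic_int_if_bounded_denominator:
  fixes K :: "'a::field_char_0 set"
  assumes K: "number_field K" and "N > 0" and x: "\<And>n. of_nat N * x ^ n \<in> \<O> K"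
  shows "algebraic_int x"
proof -
  obtain i j y where ij: "i < j" "y \<in> \<O> K" "of_nat N * x ^ j - of_nat N * x ^ i = of_nat N * y"
    using residue_collision[OF K \<open>N > 0\<close>, of "\<lambda>n. of_nat N * x ^ n"] x by blast
  then have "of_nat N * (x ^ j - x ^ i) = of_nat N * y" by (simp add: algebra_simps)
  then have y: "x ^ j - x ^ i = y" using \<open>N > 0\<close> by simp
  define q where "q = Polynomial.monom (1::'a) j - Polynomial.monom 1 i"
  have dq: "degree q = j"
  proof (rule antisym)
    show "degree q \<le> j" using ij(1) by (auto simp: q_def intro!: degree_le)
    show "j \<le> degree q" using ij(1) by (intro le_degree) (simp add: q_def)
  qed
  show ?thesis
  proof (rule algebraic_int_root)
    show "algebraic_int y" using ij by (simp add: integers_def)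
    show "poly q x = y" using y by (simp add: q_def poly_monom)
    show "\<forall>i. coeff q i \<in> \<int>" by (auto simp: q_def)
    show "lead_coeff q = 1" using ij(1) by (simp add: dq) (simp add: q_def)
    show "degree q > 0" using ij(1) by (simp add: dq)
  qed
qed

section \<open>Galois closures\<close>

text \<open>Polynomials in the univariate polynomial ring over a record are coefficient lists with
  the leading coefficient first, which explains the reversal of \<open>coeffs p\<close>.\<close>

lemma algebraic_over_Rats:
  fixes x :: "'a::field_char_0"
  assumes "algebraic x"
  shows "(type_field.algebraic over \<rat>) x"
proof -
  obtain p where p: "p \<noteq> 0" "\<forall>i. coeff p i \<in> \<rat>" "poly p x = 0"
    using assms by (auto simp: algebraic_altdef)
  have ev: "type_field.eval (rev cs) x = poly (Poly cs) x" for cs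
  proof (induction cs)
    case (Cons c cs)
    then show ?case using type_field.eval_append_aux[of "rev cs" c x] by (simp add: mult.commute)
  qed simp
  have "set (coeffs p) \<subseteq> \<rat>" using p(2) by (auto simp: coeffs_def)
  then have "rev (coeffs p) \<in> carrier (univ_poly ring_of_type_algebra \<rat>)"
    using p(1) by (auto simp: univ_poly_def polynomial_def hd_rev last_coeffs_eq_coeff_degree)
  moreover have "rev (coeffs p) \<noteq> []" using p(1) by simp
  moreover have "type_field.eval (rev (coeffs p)) x = 0"
    using ev[of "coeffs p"] p(3) by simp
  ultimately show ?thesis by (rule type_field.algebraicI)
qed

lemma algebraic_over_subfield:
  fixes x :: "'a::field_char_0"
  assumes "subfield F ring_of_type_algebra" "algebraic x"
  shows "(type_field.algebraic over F) x"
proof -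
  have "\<rat> \<subseteq> F" using subfield_closed(12)[OF assms(1)] by (auto elim: Rats_cases)
  then show ?thesis using type_field.algebraic_mono algebraic_over_Rats[OF assms(2)] by blast
qed

section \<open>Extension of embeddings of subfields\<close>

lemma mem_simple_extension_iff:
  fixes F :: "'a::field_char_0 set"
  assumes F: "subfield F ring_of_type_algebra"
  shows "x \<in> type_field.simple_extension F \<alpha> \<longleftrightarrow> (\<exists>h. (\<forall>i. coeff h i \<in> F) \<and> poly h \<alpha> = x)"
proof
  assume "x \<in> type_field.simple_extension F \<alpha>"
  then show "\<exists>h. (\<forall>i. coeff h i \<in> F) \<and> poly h \<alpha> = x"
  proof (induction rule: type_field.simple_extension.induct)
    case zero
    show ?case using subfield_closed(1)[OF F] by (intro exI[of _ 0]) simp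
  next
    case (lin k1 k2)
    then obtain h where "\<forall>i. coeff h i \<in> F" "poly h \<alpha> = k1" by blast
    then show ?case using lin
      by (intro exI[of _ "pCons k2 h"]) (auto simp: coeff_pCons mult.commute split: nat.splits)
  qed
next
  have "(\<forall>i. coeff h i \<in> F) \<Longrightarrow> poly h \<alpha> \<in> type_field.simple_extension F \<alpha>" for h
  proof (induction h)
    case 0
    show ?case using type_field.simple_extension.zero[of F \<alpha>] by simp
  next
    case (pCons a h)
    have "coeff h i \<in> F" for i using pCons.prems[rule_format, of "Suc i"] by simp
    then have "poly h \<alpha> \<in> type_field.simple_extension F \<alpha>" using pCons.IH by blast
    then show ?case
      using type_field.simple_extension.lin[of "poly h \<alpha>" F \<alpha> a] pCons.prems[rule_format, of 0]
      by (simp add: mult.commute add.commute)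
  qed
  then show "\<exists>h. (\<forall>i. coeff h i \<in> F) \<and> poly h \<alpha> = x \<Longrightarrow> x \<in> type_field.simple_extension F \<alpha>"
    by blast
qed

text \<open>The map is total, with arbitrary values off \<open>F\<close>; an extension is therefore
  another map of the same type that agrees on \<open>F\<close>.\<close>

definition embedding_on :: "'a::field_char_0 set \<Rightarrow> ('a \<Rightarrow> 'a) \<Rightarrow> bool" where
  "embedding_on F \<tau> \<longleftrightarrow> \<tau> 1 = 1 \<and>
     (\<forall>x\<in>F. \<forall>y\<in>F. \<tau> (x + y) = \<tau> x + \<tau> y \<and> \<tau> (x * y) = \<tau> x * \<tau> y)"

locale subfield_embedding =
  fixes F :: "'a::field_char_0 set" and \<tau> :: "'a \<Rightarrow> 'a"
  assumes F: "subfield F ring_of_type_algebra" and emb: "embedding_on F \<tau>"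
begin

lemmas Fcl = subfield_closed[OF F]

lemma \<tau>_1: "\<tau> 1 = 1"
  and \<tau>_add: "x \<in> F \<Longrightarrow> y \<in> F \<Longrightarrow> \<tau> (x + y) = \<tau> x + \<tau> y"
  and \<tau>_mult: "x \<in> F \<Longrightarrow> y \<in> F \<Longrightarrow> \<tau> (x * y) = \<tau> x * \<tau> y"
  using emb by (auto simp: embedding_on_def)

lemma \<tau>_0: "\<tau> 0 = 0"
  using \<tau>_add[OF Fcl(1) Fcl(1)] by simp

lemma \<tau>_minus: "x \<in> F \<Longrightarrow> \<tau> (- x) = - \<tau> x"
  using \<tau>_add[of x "- x"] Fcl(5)[of x] \<tau>_0 by (simp add: eq_neg_iff_add_eq_0 add.commute)

lemma sum_mem: "(\<And>i. i \<in> I \<Longrightarrow> f i \<in> F) \<Longrightarrow> (\<Sum>i\<in>I. f i) \<in> F"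
  by (induction I rule: infinite_finite_induct) (auto intro: Fcl)

lemma \<tau>_sum: "(\<And>i. i \<in> I \<Longrightarrow> f i \<in> F) \<Longrightarrow> \<tau> (\<Sum>i\<in>I. f i) = (\<Sum>i\<in>I. \<tau> (f i))"
  by (induction I rule: infinite_finite_induct) (auto simp: \<tau>_0 \<tau>_add sum_mem)

definition poly_over :: "'a poly \<Rightarrow> bool" where
  "poly_over h \<longleftrightarrow> (\<forall>i. coeff h i \<in> F)"

lemma poly_over_add: "poly_over h \<Longrightarrow> poly_over k \<Longrightarrow> poly_over (h + k)"
  and poly_over_diff: "poly_over h \<Longrightarrow> poly_over k \<Longrightarrow> poly_over (h - k)"
  and poly_over_mult: "poly_over h \<Longrightarrow> poly_over k \<Longrightarrow> poly_over (h * k)"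
  and poly_over_monom: "a \<in> F \<Longrightarrow> poly_over (Polynomial.monom a n)"
  and poly_over_smult: "a \<in> F \<Longrightarrow> poly_over h \<Longrightarrow> poly_over (Polynomial.smult a h)"
  unfolding poly_over_def by (auto simp: coeff_mult Fcl intro!: sum_mem Fcl)

abbreviation "\<tau>p \<equiv> map_poly \<tau>"

lemma coeff_\<tau>p: "coeff (\<tau>p h) i = \<tau> (coeff h i)"
  by (simp add: coeff_map_poly \<tau>_0)

lemma \<tau>p_add: "poly_over h \<Longrightarrow> poly_over k \<Longrightarrow> \<tau>p (h + k) = \<tau>p h + \<tau>p k"
  by (intro poly_eqI) (simp add: coeff_\<tau>p poly_over_def \<tau>_add)

lemma \<tau>p_diff:
  assumes "poly_over h" "poly_over k" shows "\<tau>p (h - k) = \<tau>p h - \<tau>p k"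
  using \<tau>p_add[OF poly_over_diff[OF assms] assms(2)] by simp

lemma \<tau>p_mult: "poly_over h \<Longrightarrow> poly_over k \<Longrightarrow> \<tau>p (h * k) = \<tau>p h * \<tau>p k"
  by (intro poly_eqI) (auto simp: coeff_\<tau>p coeff_mult poly_over_def \<tau>_mult \<tau>_sum Fcl)

lemma \<tau>p_monom: "\<tau>p (Polynomial.monom a n) = Polynomial.monom (\<tau> a) n"
  by (rule map_poly_monom) (rule \<tau>_0)

text \<open>Elements of the simple extension are values \<open>poly h \<alpha>\<close>, to be sent
  to \<open>poly (\<tau>p h) \<beta>\<close>. The assumption \<open>ker\<close> says exactly that
  the result does not depend on the choice of \<open>h\<close>.\<close>

lemma extend_with_value:
  assumes ker: "\<And>h. poly_over h \<Longrightarrow> poly h \<alpha> = 0 \<Longrightarrow> poly (\<tau>p h) \<beta> = 0"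
  shows "\<exists>\<sigma>. embedding_on (type_field.simple_extension F \<alpha>) \<sigma> \<and> (\<forall>x\<in>F. \<sigma> x = \<tau> x) \<and> \<sigma> \<alpha> = \<beta>"
proof -
  define \<sigma> where "\<sigma> x = poly (\<tau>p (SOME h. poly_over h \<and> poly h \<alpha> = x)) \<beta>" for x
  have \<sigma>: "\<sigma> (poly h \<alpha>) = poly (\<tau>p h) \<beta>" if h: "poly_over h" for h
  proof -
    define k where "k = (SOME k. poly_over k \<and> poly k \<alpha> = poly h \<alpha>)"
    have k: "poly_over k" "poly k \<alpha> = poly h \<alpha>"
      using someI[of "\<lambda>k. poly_over k \<and> poly k \<alpha> = poly h \<alpha>" h] h by (auto simp: k_def)
    have "poly (\<tau>p (k - h)) \<beta> = 0"
      by (rule ker) (use k h poly_over_diff in auto)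
    then show ?thesis using \<tau>p_diff[OF k(1) h] by (simp add: \<sigma>_def k_def)
  qed
  have ext: "x \<in> type_field.simple_extension F \<alpha> \<longleftrightarrow> (\<exists>h. poly_over h \<and> poly h \<alpha> = x)" for x
    unfolding poly_over_def by (rule mem_simple_extension_iff[OF F])
  have const: "\<sigma> a = \<tau> a" if "a \<in> F" for a
    using \<sigma>[OF poly_over_monom[OF that, of 0]] by (simp add: \<tau>p_monom poly_monom)
  have "\<sigma> \<alpha> = \<beta>"
    using \<sigma>[OF poly_over_monom[OF Fcl(2), of 1]] by (simp add: \<tau>p_monom poly_monom \<tau>_1)
  moreover have "embedding_on (type_field.simple_extension F \<alpha>) \<sigma>"
    unfolding embedding_on_def
  proof (intro conjI ballI)
    show "\<sigma> 1 = 1" using const[OF Fcl(2)] \<tau>_1 by simp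
    fix x y assume "x \<in> type_field.simple_extension F \<alpha>" "y \<in> type_field.simple_extension F \<alpha>"
    then obtain h k where hk: "poly_over h" "poly h \<alpha> = x" "poly_over k" "poly k \<alpha> = y"
      unfolding ext by blast
    show "\<sigma> (x + y) = \<sigma> x + \<sigma> y"
      using \<sigma>[OF poly_over_add[OF hk(1,3)]] \<sigma>[OF hk(1)] \<sigma>[OF hk(3)] hk \<tau>p_add by simp
    show "\<sigma> (x * y) = \<sigma> x * \<sigma> y"
      using \<sigma>[OF poly_over_mult[OF hk(1,3)]] \<sigma>[OF hk(1)] \<sigma>[OF hk(3)] hk \<tau>p_mult by simp
  qed
  ultimately show ?thesis using const by blast
qed

lemma ex_minimal_polynomial:
  assumes "algebraic \<alpha>"
  obtains m where "poly_over m" "lead_coeff m = 1" "poly m \<alpha> = 0"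
    "\<forall>h. poly_over h \<longrightarrow> poly h \<alpha> = 0 \<longrightarrow> h \<noteq> 0 \<longrightarrow> degree m \<le> degree h"
proof -
  define P where "P h \<longleftrightarrow> poly_over h \<and> poly h \<alpha> = 0 \<and> h \<noteq> 0" for h
  obtain q where q: "\<forall>i. coeff q i \<in> \<int>" "q \<noteq> 0" "poly q \<alpha> = 0"
    using assms by (auto simp: algebraic_def)
  have "coeff q i \<in> F" for i using q(1)[rule_format, of i] Fcl(10) by (auto elim!: Ints_cases)
  then have "P q" using q by (simp add: P_def poly_over_def)
  then have "\<exists>m0. P m0 \<and> (\<forall>h. P h \<longrightarrow> degree m0 \<le> degree h)"
    by (rule ex_has_least_nat)
  then obtain m0 where m0: "P m0" "\<And>h. P h \<Longrightarrow> degree m0 \<le> degree h" by blast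
  define m where "m = Polynomial.smult (inverse (lead_coeff m0)) m0"
  show thesis
  proof (rule that[of m])
    show "poly_over m" unfolding m_def using m0(1)
      by (intro poly_over_smult Fcl(7)) (auto simp: P_def poly_over_def)
    show "lead_coeff m = 1" using m0(1) by (simp add: m_def P_def)
    show "poly m \<alpha> = 0" using m0(1) by (simp add: m_def P_def)
    show "\<forall>h. poly_over h \<longrightarrow> poly h \<alpha> = 0 \<longrightarrow> h \<noteq> 0 \<longrightarrow> degree m \<le> degree h"
      using m0(2) by (simp add: m_def P_def)
  qed
qed

text \<open>Provides \<open>ker\<close> for any root \<open>\<beta>\<close> of the transported
  minimal polynomial. This is division by the monic \<open>m\<close>, one leading term at a time,
  with all coefficients staying in \<open>F\<close>, where \<open>\<tau>\<close> is additive and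
  multiplicative.\<close>

lemma minimal_polynomial_kernel:
  assumes m: "poly_over m" "lead_coeff m = 1" "poly m \<alpha> = 0"
    and min: "\<forall>h. poly_over h \<longrightarrow> poly h \<alpha> = 0 \<longrightarrow> h \<noteq> 0 \<longrightarrow> degree m \<le> degree h"
    and \<beta>: "poly (\<tau>p m) \<beta> = 0"
    and h: "poly_over h" "poly h \<alpha> = 0"
  shows "poly (\<tau>p h) \<beta> = 0"
  using h
proof (induction "degree h" arbitrary: h rule: less_induct)
  case less
  show ?case
  proof (cases "h = 0")
    case False
    define k where "k = Polynomial.monom (lead_coeff h) (degree h - degree m)"
    define h' where "h' = h - k * m"
    have le: "degree m \<le> degree h" using min less.prems False by blast
    have k: "poly_over k" unfolding k_def using less.prems
      by (intro poly_over_monom) (auto simp: poly_over_def)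
    have km: "poly_over (k * m)" using k m(1) by (rule poly_over_mult)
    have h': "poly_over h'" "poly h' \<alpha> = 0"
      using less.prems km m(3) by (auto simp: h'_def poly_over_diff)
    have "poly (\<tau>p h') \<beta> = 0"
    proof (cases "h' = 0")
      case False
      have "degree (k * m) \<le> degree h"
        using degree_mult_le[of k m] degree_monom_le[of "lead_coeff h" "degree h - degree m"] le
        by (simp add: k_def)
      then have "degree h' \<le> degree h" by (simp add: h'_def degree_diff_le)
      moreover have "coeff h' (degree h) = 0"
        using m(2) le by (simp add: h'_def k_def coeff_monom_mult)
      ultimately have "degree h' < degree h" using eq_zero_or_degree_less False by blast
      then show ?thesis using less.hyps h' by blast
    qed simp
    moreover have "\<tau>p h = \<tau>p h' + \<tau>p k * \<tau>p m"
      using \<tau>p_add[OF h'(1) km] \<tau>p_mult[OF k m(1)] by (simp add: h'_def)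
    ultimately show ?thesis using \<beta> by simp
  qed simp
qed

end

text \<open>The leading coefficient \<open>1\<close> survives under \<open>\<tau>\<close>, so the
  transported minimal polynomial is nonconstant and has a root in the algebraically closed type;
  \<open>\<alpha>\<close> is sent there.\<close>

lemma embedding_extend:
  fixes F :: "'a::{alg_closed_field, field_char_0} set"
  assumes "subfield F ring_of_type_algebra" "embedding_on F \<tau>" "algebraic \<alpha>"
  shows "\<exists>\<sigma>. embedding_on (type_field.simple_extension F \<alpha>) \<sigma> \<and> (\<forall>x\<in>F. \<sigma> x = \<tau> x)"
proof -
  interpret subfield_embedding F \<tau> using assms(1,2) by (rule subfield_embedding.intro)
  obtain m where m: "poly_over m" "lead_coeff m = 1" "poly m \<alpha> = 0"
    "\<forall>h. poly_over h \<longrightarrow> poly h \<alpha> = 0 \<longrightarrow> h \<noteq> 0 \<longrightarrow> degree m \<le> degree h"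
    by (rule ex_minimal_polynomial[OF assms(3)])
  have "degree m \<noteq> 0"
  proof
    assume "degree m = 0"
    then obtain a where "m = [:a:]" by (rule degree_eq_zeroE)
    then show False using m(2,3) by simp
  qed
  moreover have "degree m \<le> degree (\<tau>p m)"
    by (rule le_degree) (simp add: coeff_\<tau>p m(2) \<tau>_1)
  ultimately obtain \<beta> where "poly (\<tau>p m) \<beta> = 0"
    using alg_closed_imp_poly_has_root[of "\<tau>p m"] by auto
  then show ?thesis
    using extend_with_value[OF minimal_polynomial_kernel[OF m]] by blast
qed

lemma embedding_extend_list:
  fixes F :: "'a::{alg_closed_field, field_char_0} set"
  assumes F: "subfield F ring_of_type_algebra" and "embedding_on F \<tau>"
    and "\<And>x. x \<in> set xs \<Longrightarrow> algebraic x"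
  shows "\<exists>\<sigma>. embedding_on (type_field.finite_extension F xs) \<sigma> \<and> (\<forall>x\<in>F. \<sigma> x = \<tau> x)"
  using assms(3)
proof (induction xs)
  case Nil
  then show ?case using assms(2) by auto
next
  case (Cons x xs)
  then obtain \<sigma> where \<sigma>: "embedding_on (type_field.finite_extension F xs) \<sigma>" "\<forall>x\<in>F. \<sigma> x = \<tau> x"
    by auto
  have "subfield (type_field.finite_extension F xs) ring_of_type_algebra"
    by (rule type_field.finite_extension_is_subfield[OF F])
      (use algebraic_over_subfield[OF F] Cons.prems in auto)
  from embedding_extend[OF this \<sigma>(1) Cons.prems[of x]] obtain \<sigma>' where
    \<sigma>': "embedding_on (type_field.simple_extension (type_field.finite_extension F xs) x) \<sigma>'"
      "\<forall>y\<in>type_field.finite_extension F xs. \<sigma>' y = \<sigma> y"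
    by auto
  have "F \<subseteq> type_field.finite_extension F xs"
    by (rule type_field.finite_extension_incl) auto
  then show ?case using \<sigma> \<sigma>' by (intro exI[of _ \<sigma>']) auto
qed


section \<open>Rational polynomials, conjugate roots and splitting fields\<close>

interpretation of_rat_hom: comm_ring_hom "of_rat :: rat \<Rightarrow> 'a::field_char_0"
  by unfold_locales (auto simp: of_rat_add of_rat_mult)

interpretation of_rat_poly_hom: map_poly_comm_ring_hom "of_rat :: rat \<Rightarrow> 'a::field_char_0" ..

text \<open>Otherwise \<open>f\<close> and \<open>h\<close> are coprime, and a Bezout identity
  evaluated at the common root reads \<open>0 = 1\<close>.\<close>

lemma irreducible_dvd_if_common_root:
  fixes \<theta> :: "'a::field_char_0"
  assumes f: "irreducible f" "poly (map_poly of_rat f) \<theta> = 0" and h: "poly (map_poly of_rat h) \<theta> = 0"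
  shows "f dvd h"
proof (rule ccontr)
  assume "\<not> f dvd h"
  then have "coprime f h"
    using f(1) prime_elem_imp_coprime irreducible_imp_prime_elem_gcd by blast
  then obtain u v where "u * f + v * h = 1"
    by (metis bezout_coefficients_fst_snd coprime_iff_gcd_eq_1)
  then have "poly (map_poly of_rat (u * f + v * h)) \<theta> = 1" by simp
  then show False using f(2) h by (simp add: of_rat_poly_hom.hom_add of_rat_poly_hom.hom_mult)
qed

text \<open>Linear factors exist by algebraic closure. They are distinct because a double root would
  be shared with \<open>pderiv f\<close>, forcing \<open>f\<close> to divide a nonzero polynomial of
  smaller degree.\<close>

lemma irreducible_rat_splits:
  fixes f :: "rat poly"
  assumes "irreducible f"
  defines "S \<equiv> {a :: 'a::{alg_closed_field, field_char_0}. poly (map_poly of_rat f) a = 0}"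
  shows "finite S" "map_poly of_rat f = Polynomial.smult (of_rat (lead_coeff f)) (\<Prod>a\<in>S. [:-a, 1:])"
proof -
  define g where "g = (map_poly of_rat f :: 'a poly)"
  have f0: "f \<noteq> 0" "degree f > 0"
    using assms(1) by (auto simp: irreducible_def is_unit_iff_degree)
  have lg: "lead_coeff g = of_rat (lead_coeff f)"
    by (simp add: g_def degree_map_poly coeff_map_poly)
  then have g0: "g \<noteq> 0" using f0 by auto
  then show fin: "finite S" unfolding S_def g_def[symmetric] by (rule poly_roots_finite)
  obtain A where A: "g = Polynomial.smult (lead_coeff g) (\<Prod>x\<in>#A. [:-x, 1:])"
    using alg_closed_imp_factorization[OF g0] by blast
  have sep: "poly (pderiv g) a \<noteq> 0" if a: "poly g a = 0" for a
  proof
    assume "poly (pderiv g) a = 0"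
    moreover have "pderiv g = map_poly of_rat (pderiv f)"
      by (intro poly_eqI) (simp add: g_def coeff_pderiv coeff_map_poly of_rat_mult of_rat_add)
    ultimately have "poly (map_poly of_rat (pderiv f)) a = 0" by simp
    then have "f dvd pderiv f"
      using irreducible_dvd_if_common_root[OF assms(1)] a unfolding g_def by blast
    then have "degree f \<le> degree (pderiv f)"
      using f0 by (intro dvd_imp_degree_le) (auto simp: pderiv_eq_0_iff)
    then show False using f0 by (simp add: degree_pderiv)
  qed
  have "set_mset A = S"
  proof -
    have "poly g a = 0 \<longleftrightarrow> a \<in># A" for a
    proof -
      have "poly g a = 0 \<longleftrightarrow> poly (\<Prod>x\<in>#A. [:-x, 1:]) a = 0"
        by (subst A) (use g0 in simp)
      also have "\<dots> \<longleftrightarrow> a \<in># A"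
        by (induction A) auto
      finally show ?thesis .
    qed
    then show ?thesis by (auto simp: S_def g_def)
  qed
  moreover have "count A a \<le> 1" for a
  proof (rule ccontr)
    assume "\<not> count A a \<le> 1"
    then have "{#a, a#} \<subseteq># A" by (auto simp: subseteq_mset_def)
    then obtain B where B: "A = {#a, a#} + B" by (auto simp: mset_subset_eq_exists_conv)
    define r where "r = Polynomial.smult (lead_coeff g) (\<Prod>x\<in>#B. [:-x, 1:])"
    define l where "l = [:-a, 1:]"
    have "g = l * (l * r)"
      by (subst A) (simp add: B r_def l_def)
    moreover have "poly l a = 0" by (simp add: l_def)
    ultimately have "poly g a = 0" "poly (pderiv g) a = 0"
      by (simp_all add: pderiv_mult)
    then show False using sep by blast
  qed
  ultimately have "A = mset_set S"
    by (intro multiset_eqI) (metis One_nat_def count_eq_zero_iff count_mset_set(1,3) fin le_SucE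
        le_zero_eq)
  then show "map_poly of_rat f = Polynomial.smult (of_rat (lead_coeff f)) (\<Prod>a\<in>S. [:-a, 1:])"
    using A lg by (simp add: g_def prod_unfold_prod_mset)
qed

lemma embedding_fixes_Rats:
  assumes "subfield M ring_of_type_algebra" "embedding_on M \<sigma>"
  shows "\<sigma> (of_rat r) = of_rat r"
proof -
  interpret subfield_embedding M \<sigma> using assms by (rule subfield_embedding.intro)
  have nat: "\<sigma> (of_nat n) = of_nat n" for n
    by (induction n) (simp_all add: \<tau>_0 \<tau>_1 \<tau>_add Fcl)
  have int: "\<sigma> (of_int n) = of_int n" for n
  proof (cases n)
    case (nonneg k)
    then show ?thesis using nat[of k] by simp
  next
    case (neg k)
    then show ?thesis using nat[of "Suc k"] \<tau>_minus[OF Fcl(11)[of "Suc k"]]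
      by (simp del: of_nat_Suc)
  qed
  obtain a b where ab: "r = of_int a / of_int b" "b \<noteq> 0"
    by (metis quotient_of_div quotient_of_denom_pos less_irrefl surj_pair)
  have "of_int b * of_rat r = (of_int a :: 'a)" using ab by (simp add: of_rat_divide)
  then have "of_int b * \<sigma> (of_rat r) = of_int b * of_rat r"
    using \<tau>_mult[OF Fcl(10)[of b] Fcl(12)[of r]] int[of a] int[of b] by metis
  then show ?thesis using ab(2) by simp
qed

lemma embedding_rat_poly:
  assumes M: "subfield M ring_of_type_algebra" "embedding_on M \<sigma>" and x: "x \<in> M"
  shows "\<sigma> (poly (map_poly of_rat g) x) = poly (map_poly of_rat g) (\<sigma> x)"
proof -
  interpret subfield_embedding M \<sigma> using M by (rule subfield_embedding.intro)
  have "poly (map_poly of_rat g) x \<in> M \<and> ?thesis"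
  proof (induction g)
    case (pCons a g)
    then show ?case
      using x by (simp add: map_poly_pCons \<tau>_add \<tau>_mult Fcl embedding_fixes_Rats[OF M])
  qed (simp add: \<tau>_0 Fcl)
  then show ?thesis by blast
qed

lemma algebraic_iff_rat_poly:
  fixes x :: "'a::field_char_0"
  shows "algebraic x \<longleftrightarrow> (\<exists>g. g \<noteq> 0 \<and> poly (map_poly of_rat g) x = 0)"
proof
  assume "algebraic x"
  then obtain p where p: "p \<noteq> 0" "poly (map_poly of_int p) x = 0" by (erule algebraicE')
  have "map_poly of_rat (map_poly of_int p) = (map_poly of_int p :: 'a poly)"
    by (intro poly_eqI) (simp add: coeff_map_poly)
  moreover have "map_poly of_int p \<noteq> (0 :: rat poly)" using p(1) by simp
  ultimately show "\<exists>g. g \<noteq> 0 \<and> poly (map_poly of_rat g) x = 0" using p(2) by metis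
next
  assume "\<exists>g. g \<noteq> 0 \<and> poly (map_poly of_rat g) x = 0"
  then obtain g where g: "g \<noteq> 0" "poly (map_poly of_rat g) x = 0" by blast
  have "map_poly of_rat g \<noteq> (0 :: 'a poly)"
    using g(1) by (metis coeff_0 coeff_map_poly leading_coeff_0_iff of_rat_0 of_rat_eq_iff)
  then show "algebraic x"
    unfolding algebraic_altdef using g(2)
    by (intro exI[of _ "map_poly of_rat g"]) (auto simp: coeff_map_poly)
qed

text \<open>The embedding sending \<open>\<theta>\<close> to
  \<open>\<theta>'\<close> extends to the splitting field and permutes the roots that generate it.\<close>

lemma splitting_field_normal:
  fixes g :: "rat poly" and \<theta> \<theta>' :: "'a::{alg_closed_field, field_char_0}"
  assumes xs: "set xs = {x. poly (map_poly of_rat g) x = 0}" and g: "g \<noteq> 0"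
    and L: "L = type_field.finite_extension \<rat> xs"
    and f: "irreducible f" "poly (map_poly of_rat f) \<theta> = 0" "poly (map_poly of_rat f) \<theta>' = 0"
    and \<theta>: "\<theta> \<in> L"
  shows "\<theta>' \<in> L"
proof -
  have alg: "algebraic x" if "x \<in> set xs" for x
    using that g xs by (auto simp: algebraic_iff_rat_poly)
  have f0: "f \<noteq> 0" using f(1) by auto
  have alg\<theta>: "algebraic \<theta>" using f0 f(2) by (auto simp: algebraic_iff_rat_poly)
  interpret Q: subfield_embedding "\<rat> :: 'a set" id
    by (rule subfield_embedding.intro[OF subfield_Rats]) (auto simp: embedding_on_def)
  \<comment> \<open>A rational polynomial vanishing at \<open>\<theta>\<close> is a multiple of the
    irreducible \<open>f\<close>, so it vanishes at the conjugate \<open>\<theta>'\<close> as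
    well.\<close>
  have ker: "poly (map_poly id h) \<theta>' = 0" if h: "Q.poly_over h" "poly h \<theta> = 0" for h
  proof -
    have "\<forall>i. \<exists>r. coeff h i = of_rat r" using h(1) by (auto simp: Q.poly_over_def elim: Rats_cases)
    then obtain c where c: "\<And>i. coeff h i = of_rat (c i)" by metis
    define h0 where "h0 = (\<Sum>i\<le>degree h. Polynomial.monom (c i) i)"
    have "coeff h0 i = c i" for i
      using c[of i] by (cases "i \<le> degree h") (auto simp: h0_def coeff_sum coeff_eq_0)
    then have h0: "map_poly of_rat h0 = h"
      by (intro poly_eqI) (simp add: coeff_map_poly c)
    then have "f dvd h0" using irreducible_dvd_if_common_root[OF f(1,2)] h(2) by blast
    then obtain k where "h0 = f * k" by auto
    then have "h = map_poly of_rat f * map_poly of_rat k"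
      using h0 by (simp add: of_rat_poly_hom.hom_mult)
    then show ?thesis using f(3) by (simp add: map_poly_id)
  qed
  define F where "F = type_field.simple_extension \<rat> \<theta>"
  obtain \<tau> where \<tau>: "embedding_on F \<tau>" "\<tau> \<theta> = \<theta>'"
    using Q.extend_with_value[of \<theta> \<theta>'] ker unfolding F_def by blast
  have F: "subfield F ring_of_type_algebra"
    unfolding F_def using type_field.simple_extension_is_subfield[OF subfield_Rats, of \<theta>]
      algebraic_over_Rats[OF alg\<theta>] by simp
  define M where "M = type_field.finite_extension F xs"
  obtain \<sigma> where \<sigma>: "embedding_on M \<sigma>" "\<And>x. x \<in> F \<Longrightarrow> \<sigma> x = \<tau> x"
    using embedding_extend_list[OF F \<tau>(1) alg] unfolding M_def by blast
  have M: "subfield M ring_of_type_algebra"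
    unfolding M_def by (rule type_field.finite_extension_is_subfield[OF F])
      (use algebraic_over_subfield[OF F] alg in auto)
  have sL: "subring L ring_of_type_algebra"
    unfolding L by (rule type_field.finite_extension_is_subring[OF subfieldE(1)[OF subfield_Rats]]) simp
  have QF: "\<rat> \<subseteq> F" using subfield_closed(12)[OF F] by (auto elim: Rats_cases)
  have LM: "L \<subseteq> M" unfolding L M_def by (rule type_field.mono_finite_extension[OF QF])
  have xsL: "set xs \<subseteq> L"
    unfolding L using type_field.finite_extension_mem[OF subfieldE(1)[OF subfield_Rats], of xs] by simp
  have QL: "\<rat> \<subseteq> L"
    unfolding L by (rule type_field.finite_extension_incl) auto
  interpret M: subfield_embedding M \<sigma> using M \<sigma>(1) by (rule subfield_embedding.intro)
  note sr = subringE[OF sL, simplified]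
  \<comment> \<open>\<open>L'\<close> is the part of \<open>L\<close> that \<open>\<sigma>\<close>
    maps back into \<open>L\<close>. It is a subring containing the rationals and the generating
    roots, hence all of \<open>L\<close>.\<close>
  define L' where "L' = {x \<in> L. \<sigma> x \<in> L}"
  have "subring L' ring_of_type_algebra"
  proof (rule type_field.subringI)
    show "1 \<in> L'" using sr(3) M.\<tau>_1 by (simp add: L'_def)
    show "\<ominus>\<^bsub>ring_of_type_algebra\<^esub> h \<in> L'" if "h \<in> L'" for h
    proof -
      have "\<sigma> (- h) = - \<sigma> h" by (rule M.\<tau>_minus) (use that LM in \<open>auto simp: L'_def\<close>)
      then show ?thesis using that sr(5) by (auto simp: L'_def)
    qed
    fix x y assume xy: "x \<in> L'" "y \<in> L'"
    have "\<sigma> (x * y) = \<sigma> x * \<sigma> y" "\<sigma> (x + y) = \<sigma> x + \<sigma> y"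
      by (rule M.\<tau>_mult M.\<tau>_add; use xy LM in \<open>auto simp: L'_def\<close>)+
    then show "x * y \<in> L'" "x + y \<in> L'"
      using xy sr(6,7) by (simp_all add: L'_def)
  qed simp
  moreover have "\<rat> \<subseteq> L'"
    using QL embedding_fixes_Rats[OF M \<sigma>(1)] by (auto simp: L'_def elim!: Rats_cases)
  moreover have "set xs \<subseteq> L'"
  proof
    fix x assume x: "x \<in> set xs"
    then have "poly (map_poly of_rat g) (\<sigma> x) = \<sigma> 0"
      using embedding_rat_poly[OF M \<sigma>(1), of x g] xsL LM xs by auto
    then have "\<sigma> x \<in> set xs" using xs M.\<tau>_0 by simp
    then show "x \<in> L'" using x xsL by (auto simp: L'_def)
  qed
  ultimately have "L \<subseteq> L'"
    unfolding L by (rule type_field.finite_extension_subring_incl)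
  then have "\<sigma> \<theta> \<in> L" using \<theta> by (auto simp: L'_def)
  moreover have "\<theta> \<in> F"
    unfolding F_def by (rule type_field.simple_extension_mem[OF subfieldE(1)[OF subfield_Rats]]) simp
  ultimately show ?thesis using \<sigma>(2) \<tau>(2) by simp
qed

text \<open>\<open>L\<close> is generated by all roots of one polynomial \<open>g\<close> that
  vanishes on a spanning list of \<open>K\<close>. Existence is what gives the choice
  \<open>galois_extension_of\<close> its properties.\<close>

lemma ex_galois_extension:
  fixes K :: "'a::{alg_closed_field, field_char_0} set"
  assumes "number_field K"
  shows "\<exists>L. K \<subseteq> L \<and> galois_over_rat L"
proof -
  have fd: "type_field.finite_dimension \<rat> K"
    using assms by (auto simp: number_field_def)
  then obtain Us where Us: "type_field.Span \<rat> Us = K"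
    using type_field.exists_base[OF subfield_Rats] by (metis type_field.finite_dimensionE')
  have "set Us \<subseteq> K"
    using type_field.Span_base_incl[OF subfield_Rats, of Us] Us by simp
  then have "\<exists>g. g \<noteq> 0 \<and> (\<forall>u\<in>set Us. poly (map_poly of_rat g) u = 0)"
  proof (induction Us)
    case Nil
    show ?case by (intro exI[of _ 1]) simp
  next
    case (Cons u Us)
    then obtain g where g: "g \<noteq> 0" "\<forall>u\<in>set Us. poly (map_poly of_rat g) u = 0" by auto
    obtain h where h: "h \<noteq> 0" "poly (map_poly of_rat h) u = 0"
      using number_field_algebraic[OF assms, of u] Cons.prems by (auto simp: algebraic_iff_rat_poly)
    show ?case using g h by (intro exI[of _ "h * g"]) (auto simp: of_rat_poly_hom.hom_mult)
  qed
  then obtain g where g: "g \<noteq> 0" "\<And>u. u \<in> set Us \<Longrightarrow> poly (map_poly of_rat g) u = 0" by blast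
  have "map_poly of_rat g \<noteq> (0 :: 'a poly)"
    using g(1) by (metis coeff_0 coeff_map_poly leading_coeff_0_iff of_rat_0 of_rat_eq_iff)
  then have "finite {x :: 'a. poly (map_poly of_rat g) x = 0}"
    by (rule poly_roots_finite)
  then obtain xs where xs: "set xs = {x :: 'a. poly (map_poly of_rat g) x = 0}"
    using finite_list by blast
  define L where "L = type_field.finite_extension \<rat> xs"
  have alg: "(type_field.algebraic over \<rat>) x" if "x \<in> set xs" for x
    using that g(1) xs by (intro algebraic_over_Rats) (auto simp: algebraic_iff_rat_poly)
  have "number_field L"
    unfolding number_field_def L_def
    using type_field.finite_extension_is_subfield[OF subfield_Rats, of xs]
      type_field.finite_extension_finite_dimension(1)[OF subfield_Rats, of xs] alg by auto
  moreover have "K \<subseteq> L"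
  proof -
    have "set Us \<subseteq> L"
      using type_field.finite_extension_mem[OF subfieldE(1)[OF subfield_Rats], of xs] g(2) xs
      unfolding L_def by auto
    moreover have "subalgebra \<rat> L ring_of_type_algebra"
      using \<open>number_field L\<close> type_field.finite_dimension_imp_subalgebra[OF subfield_Rats]
      by (auto simp: number_field_def)
    ultimately show ?thesis
      using type_field.subalgebra_Span_incl[OF subfield_Rats] Us by blast
  qed
  moreover have "galois_over_rat L"
    unfolding galois_over_rat_def
  proof (intro conjI allI impI)
    fix f :: "rat poly"
    assume f: "irreducible f \<and> (\<exists>x\<in>L. poly (map_poly of_rat f) x = 0)"
    then obtain \<theta> where \<theta>: "\<theta> \<in> L" "poly (map_poly of_rat f) \<theta> = 0" by blast
    define S where "S = {a :: 'a. poly (map_poly of_rat f) a = 0}"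
    have "S \<subseteq> L"
      using splitting_field_normal[OF xs g(1) L_def _ \<theta>(2) _ \<theta>(1)] f by (auto simp: S_def)
    then show "\<exists>S. finite S \<and> S \<subseteq> L \<and>
        map_poly of_rat f = Polynomial.smult (of_rat (lead_coeff f)) (\<Prod>a\<in>S. [:- a, 1:])"
      using irreducible_rat_splits[of f] f unfolding S_def by blast
  qed fact
  ultimately show ?thesis by blast
qed

section \<open>Prime ideals and valuations\<close>

lemma ideal_ring_of_integers_iff:
  fixes K :: "'a::field_char_0 set"
  assumes K: "number_field K"
  shows "ideal J (ring_of_integers K) \<longleftrightarrow> J \<subseteq> \<O> K \<and> 0 \<in> J \<and>
    (\<forall>x\<in>J. \<forall>y\<in>J. x + y \<in> J) \<and> (\<forall>a\<in>\<O> K. \<forall>x\<in>J. a * x \<in> J)"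
    (is "?l \<longleftrightarrow> ?r")
proof
  interpret cring "ring_of_integers K" by (rule cring_ring_of_integers[OF K])
  assume ?l
  then interpret J: ideal J "ring_of_integers K" .
  show ?r
    using J.Icarr J.a_closed J.I_l_closed J.zero_closed by auto
next
  interpret cring "ring_of_integers K" by (rule cring_ring_of_integers[OF K])
  assume r: ?r
  have neg: "- x \<in> J" if "x \<in> J" for x
    using r that integers_closed(8)[OF K, of "-1"] by force
  show ?l
  proof (rule idealI)
    show "subgroup J (add_monoid (ring_of_integers K))"
    proof (rule add.subgroupI)
      fix x assume x: "x \<in> J"
      have "\<ominus>\<^bsub>ring_of_integers K\<^esub> x = - x"
        by (rule minus_equality) (use r x neg in auto)
      then show "\<ominus>\<^bsub>ring_of_integers K\<^esub> x \<in> J" using neg x by simp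
    qed (use r in auto)
    show "x \<otimes>\<^bsub>ring_of_integers K\<^esub> a \<in> J" "a \<otimes>\<^bsub>ring_of_integers K\<^esub> x \<in> J"
      if "a \<in> J" "x \<in> carrier (ring_of_integers K)" for a x
      using r that by (simp_all add: mult.commute[of a])
  qed (rule ring_axioms)
qed

text \<open>An ideal containing \<open>N\<close> is a union of residue classes modulo
  \<open>N\<close>, so its intersection with a finite set of representatives determines it.\<close>

lemma finite_ideals_containing:
  fixes K :: "'a::field_char_0 set"
  assumes K: "number_field K" and "N > 0"
  shows "finite {J. ideal J (ring_of_integers K) \<and> of_nat N \<in> J}"
proof -
  obtain S where S: "finite S" "\<And>x. x \<in> \<O> K \<Longrightarrow> \<exists>s\<in>S. \<exists>y\<in>\<O> K. x = s + of_nat N * y"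
    using finite_residues[OF assms] by blast
  have sub: "J \<subseteq> J'" if J: "ideal J (ring_of_integers K)" "of_nat N \<in> J"
    and J': "ideal J' (ring_of_integers K)" "of_nat N \<in> J'" and eq: "J \<inter> S = J' \<inter> S" for J J'
  proof
    note Ji = J(1)[unfolded ideal_ring_of_integers_iff[OF K]]
    note Ji' = J'(1)[unfolded ideal_ring_of_integers_iff[OF K]]
    fix x assume x: "x \<in> J"
    then obtain s y where s: "s \<in> S" "y \<in> \<O> K" "x = s + of_nat N * y"
      using S(2) Ji by blast
    have y': "- y \<in> \<O> K" using s integers_closed[OF K] by blast
    have "x + (- y) * of_nat N \<in> J" using Ji x y' J(2) by blast
    then have "s \<in> J" using s by (simp add: algebra_simps)
    then have "s \<in> J'" using eq s by blast
    then have "s + y * of_nat N \<in> J'" using Ji' s J'(2) by blast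
    then show "x \<in> J'" using s by (simp add: algebra_simps)
  qed
  have "inj_on (\<lambda>J. J \<inter> S) {J. ideal J (ring_of_integers K) \<and> of_nat N \<in> J}"
    using sub by (intro inj_onI) (simp, blast)
  moreover have "(\<lambda>J. J \<inter> S) ` {J. ideal J (ring_of_integers K) \<and> of_nat N \<in> J} \<subseteq> Pow S"
    by auto
  ultimately show ?thesis using S(1) by (metis finite_Pow_iff inj_on_finite)
qed

locale number_field_prime =
  fixes K Q :: "'a::field_char_0 set"
  assumes K: "number_field K" and prime: "primeideal Q (ring_of_integers K)" and nonzero: "Q \<noteq> {0}"
begin

lemmas cl = integers_closed[OF K]

lemma ideal_Q: "ideal Q (ring_of_integers K)"
  using prime by (rule primeideal.axioms(1))

lemma Q_sub: "x \<in> Q \<Longrightarrow> x \<in> \<O> K"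
  and Q_0: "0 \<in> Q"
  and Q_add: "x \<in> Q \<Longrightarrow> y \<in> Q \<Longrightarrow> x + y \<in> Q"
  and Q_mult: "a \<in> \<O> K \<Longrightarrow> x \<in> Q \<Longrightarrow> a * x \<in> Q"
  using ideal_Q unfolding ideal_ring_of_integers_iff[OF K] by blast+

lemma Q_mult': "x \<in> Q \<Longrightarrow> a \<in> \<O> K \<Longrightarrow> x * a \<in> Q"
  using Q_mult by (simp add: mult.commute)

lemma Q_minus: "x \<in> Q \<Longrightarrow> - x \<in> Q"
  using Q_mult[OF cl(8)[of "-1"]] by simp

lemma Q_diff: "x \<in> Q \<Longrightarrow> y \<in> Q \<Longrightarrow> x - y \<in> Q"
  using Q_add[of x "- y"] Q_minus[of y] by simp

lemma Q_prime: "a \<in> \<O> K \<Longrightarrow> b \<in> \<O> K \<Longrightarrow> a * b \<in> Q \<Longrightarrow> a \<in> Q \<or> b \<in> Q"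
  using primeideal.I_prime[OF prime, of a b] by simp

lemma Q_1: "1 \<notin> Q"
proof
  assume "1 \<in> Q"
  then have "x \<in> Q" if "x \<in> \<O> K" for x using Q_mult[OF that, of 1] by simp
  then have "carrier (ring_of_integers K) = Q" using Q_sub by auto
  then show False using primeideal.I_notcarr[OF prime] by blast
qed

lemma Q_power: "a \<in> \<O> K \<Longrightarrow> a ^ n \<in> Q \<Longrightarrow> a \<in> Q"
proof (induction n)
  case (Suc n)
  then show ?case using Q_prime[of a "a ^ n"] cl(7)[of a n] by auto
qed (use Q_1 in simp)

text \<open>A nonzero element of \<open>Q\<close> divides a nonzero integer, which then lies in
  \<open>Q\<close>; primality passes this on to a prime factor. An integer of \<open>Q\<close> prime
  to \<open>p\<close> would yield \<open>1\<close> in \<open>Q\<close> by Bezout.\<close>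

lemma ex_lies_over: "\<exists>p. lies_over_rat_prime Q p"
proof -
  obtain a where a: "a \<in> Q" "a \<noteq> 0" using nonzero Q_0 by blast
  obtain y N where N: "y \<in> \<O> K" "N \<noteq> 0" "a * y = of_int N"
    using integer_divides_int[OF K Q_sub[OF a(1)] a(2)] .
  have "of_int N \<in> Q" using Q_mult'[OF a(1) N(1)] N(3) by simp
  then have N_mem: "of_nat (nat \<bar>N\<bar>) \<in> Q"
    using Q_minus by (cases "N \<ge> 0") (auto simp: abs_if of_nat_nat)
  have "\<exists>p. prime p \<and> of_nat p \<in> Q" if "of_nat m \<in> Q" "m > 0" for m :: nat
    using that
  proof (induction m rule: less_induct)
    case (less m)
    have "m \<noteq> 1" using less.prems Q_1 by auto
    then obtain p where p: "prime p" "p dvd m" using prime_factor_nat by blast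
    then obtain k where k: "m = p * k" by auto
    have "k < m" "k > 0" using less.prems p k prime_gt_1_nat[of p] by auto
    moreover have "of_nat p \<in> Q \<or> of_nat k \<in> Q"
      using less.prems k Q_prime[OF cl(9)[of p] cl(9)[of k]] by simp
    ultimately show ?case using less.IH less.prems p by blast
  qed
  then obtain p where p: "prime p" "of_nat p \<in> Q"
    using N_mem N(2) by (meson zero_less_abs_iff zero_less_nat_eq)
  have "of_int n \<in> Q \<longleftrightarrow> int p dvd n" for n
  proof
    assume "int p dvd n"
    then obtain k where "n = int p * k" by auto
    then show "of_int n \<in> Q" using Q_mult'[OF p(2) cl(8)[of k]] by simp
  next
    assume n: "of_int n \<in> Q"
    show "int p dvd n"
    proof (rule ccontr)
      assume "\<not> int p dvd n"
      then have "coprime n (int p)"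
        using p prime_imp_coprime[of "int p" n] by (simp add: coprime_commute)
      then obtain u v where uv: "u * n + v * int p = 1"
        using bezout_int[of n "int p"] by (auto simp: coprime_iff_gcd_eq_1)
      have "of_int u * of_int n + of_int v * of_nat p \<in> Q"
        by (intro Q_add Q_mult cl n p)
      also have "of_int u * of_int n + of_int v * of_nat p = (of_int (u * n + v * int p) :: 'a)"
        by simp
      finally show False using uv Q_1 by simp
    qed
  qed
  then show ?thesis using p by (auto simp: lies_over_rat_prime_def)
qed

lemma lies_over_unique: "lies_over_rat_prime Q p \<Longrightarrow> lies_over_rat_prime Q q \<Longrightarrow> p = q"
proof -
  assume p: "lies_over_rat_prime Q p" and q: "lies_over_rat_prime Q q"
  have *: "int p dvd n \<longleftrightarrow> int q dvd n" for n
    using p q unfolding lies_over_rat_prime_def by blast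
  have "p dvd q" "q dvd p" using *[of "int p"] *[of "int q"] by auto
  then show "p = q" by (rule dvd_antisym)
qed

lemma lies_over_prime_below: "lies_over_rat_prime Q (prime_below Q)"
  unfolding prime_below_def using ex_lies_over lies_over_unique by (metis theI)

abbreviation "p \<equiv> prime_below Q"

lemma prime_p: "prime p"
  and of_int_mem_Q: "of_int n \<in> Q \<longleftrightarrow> int p dvd n"
  using lies_over_prime_below by (auto simp: lies_over_rat_prime_def)

lemma p_mem: "of_nat p \<in> Q"
  using of_int_mem_Q[of "int p"] by simp

lemma p_pos: "p > 0"
  using prime_p prime_gt_0_nat by blast

lemma p_nonzero: "of_nat p \<noteq> (0::'a)"
  using p_pos by simp

text \<open>A finite domain is a field: two powers of \<open>s\<close> agree modulo
  \<open>p\<close>, hence modulo \<open>Q\<close>, and cancelling the lower power leaves an inverse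
  that is itself a power of \<open>s\<close>.\<close>

lemma maximal:
  assumes s: "s \<in> \<O> K" "s \<notin> Q"
  obtains s' where "s' \<in> \<O> K" "1 - s' * s \<in> Q"
proof -
  obtain i j y where ij: "i < j" "y \<in> \<O> K" "s ^ j - s ^ i = of_nat p * y"
    using residue_collision[OF K p_pos, of "\<lambda>n. s ^ n"] cl(7)[OF s(1)] by blast
  define d where "d = j - i - 1"
  have j: "j = i + Suc d" using ij(1) by (simp add: d_def)
  have "s ^ i * (1 - s ^ d * s) = - (s ^ j - s ^ i)"
    by (simp add: j power_add algebra_simps)
  also have "\<dots> \<in> Q"
    unfolding ij(3) by (intro Q_minus Q_mult' p_mem ij)
  finally have "s ^ i \<in> Q \<or> 1 - s ^ d * s \<in> Q"
    by (intro Q_prime cl s)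
  then have "1 - s ^ d * s \<in> Q" using Q_power s by blast
  then show thesis using that cl(7)[OF s(1)] by blast
qed

text \<open>Among the annihilators modulo \<open>p\<close> of elements \<open>b\<close> that are contained in \<open>Q\<close>, a maximal one
  is \<open>Q\<close> itself; then \<open>b / p\<close> lies in the inverse of \<open>Q\<close> but not in the ring.\<close>

lemma ex_annihilator:
  obtains b where "b \<in> \<O> K" "\<forall>x\<in>\<O> K. x \<in> Q \<longleftrightarrow> (\<exists>y\<in>\<O> K. b * x = of_nat p * y)"
proof -
  define W where "W b = {x \<in> \<O> K. \<exists>y\<in>\<O> K. b * x = of_nat p * y}" for b
  have W_iff: "x \<in> W b \<longleftrightarrow> x \<in> \<O> K \<and> (\<exists>y\<in>\<O> K. b * x = of_nat p * y)" for x b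
    by (simp add: W_def)
  have ideal_W: "ideal (W b) (ring_of_integers K)" if b: "b \<in> \<O> K" for b
    unfolding ideal_ring_of_integers_iff[OF K]
  proof (intro conjI ballI)
    show "W b \<subseteq> \<O> K" by (auto simp: W_def)
    show "0 \<in> W b" using cl(1) unfolding W_iff by force
    show "x + y \<in> W b" if xy: "x \<in> W b" "y \<in> W b" for x y
    proof -
      obtain u v where "u \<in> \<O> K" "b * x = of_nat p * u" "v \<in> \<O> K" "b * y = of_nat p * v"
        using xy unfolding W_iff by blast
      then have "u + v \<in> \<O> K" "b * (x + y) = of_nat p * (u + v)"
        by (intro cl(3), auto simp: algebra_simps)
      then show ?thesis using xy cl(3)[of x y] unfolding W_iff by blast
    qed
    show "a * x \<in> W b" if ax: "a \<in> \<O> K" "x \<in> W b" for a x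
    proof -
      obtain u where "u \<in> \<O> K" "b * x = of_nat p * u"
        using ax unfolding W_iff by blast
      then have "a * u \<in> \<O> K" "b * (a * x) = of_nat p * (a * u)"
        using ax(1) by (intro cl(4), auto simp: mult_ac)
      then show ?thesis using ax cl(4)[of a x] unfolding W_iff by blast
    qed
  qed
  have p_W: "of_nat p \<in> W b" if b: "b \<in> \<O> K" for b
    using b cl(9)[of p] unfolding W_iff by (auto simp: mult.commute)
  have W_mono: "W b \<subseteq> W (b * u)" if u: "u \<in> \<O> K" for b u
  proof
    fix x assume "x \<in> W b"
    then obtain y where y: "x \<in> \<O> K" "y \<in> \<O> K" "b * x = of_nat p * y" unfolding W_iff by blast
    then have "b * u * x = of_nat p * (u * y)" by (simp add: mult_ac)
    then show "x \<in> W (b * u)" using y cl(4)[OF u y(2)] unfolding W_iff by blast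
  qed
  define \<W> where "\<W> = {W b | b. b \<in> \<O> K \<and> W b \<subseteq> Q}"
  \<comment> \<open>Every \<open>W b\<close> is an ideal containing \<open>p\<close>, and there are
    only finitely many of those; so a maximal member exists.\<close>
  have "finite \<W>"
    by (rule finite_subset[OF _ finite_ideals_containing[OF K p_pos]])
      (use ideal_W p_W in \<open>auto simp: \<W>_def\<close>)
  moreover have "W 1 \<subseteq> Q"
    using Q_mult'[OF p_mem] by (auto simp: W_def)
  then have "W 1 \<in> \<W>" using cl(2) unfolding \<W>_def by blast
  ultimately obtain M where M: "M \<in> \<W>" "\<And>M'. M' \<in> \<W> \<Longrightarrow> M \<subseteq> M' \<Longrightarrow> M = M'"
    using finite_has_maximal[of \<W>] by blast
  then obtain b where b: "b \<in> \<O> K" "W b \<subseteq> Q" "M = W b" by (auto simp: \<W>_def)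
  have max: "W (b * u) = W b" if "u \<in> \<O> K" "W (b * u) \<subseteq> Q" for u
    using M(2)[of "W (b * u)"] W_mono[OF that(1), of b] that cl(4)[OF b(1) that(1)]
    unfolding \<W>_def b(3) by blast
  have "Q \<subseteq> W b"
  proof
    fix x assume x: "x \<in> Q"
    note xO = Q_sub[OF x]
    \<comment> \<open>Two powers of \<open>x\<close> agree modulo \<open>p\<close>, so
      \<open>x ^ (j - i) - 1\<close> annihilates \<open>b * x ^ i\<close>. It lies outside
      \<open>Q\<close> because \<open>x\<close> lies in \<open>Q\<close>, so multiplying
      \<open>b\<close> by powers of \<open>x\<close> eventually pushes the annihilator out of
      \<open>Q\<close>.\<close>
    obtain i j y where ij: "i < j" "y \<in> \<O> K" "x ^ j - x ^ i = of_nat p * y"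
      using residue_collision[OF K p_pos, of "\<lambda>n. x ^ n"] cl(7)[OF xO] by blast
    have "b * x ^ i * (x ^ (j - i) - 1) = b * (x ^ j - x ^ i)"
      using ij(1) by (simp add: algebra_simps flip: power_add)
    also have "\<dots> = of_nat p * (b * y)" using ij(3) by (simp add: mult_ac)
    finally have "x ^ (j - i) - 1 \<in> W (b * x ^ i)"
      using cl(4)[OF b(1) ij(2)] cl(6)[OF cl(7)[OF xO] cl(2)] unfolding W_iff by blast
    moreover have "x ^ (j - i) - 1 \<notin> Q"
    proof
      assume *: "x ^ (j - i) - 1 \<in> Q"
      have "x ^ (j - i) = x * x ^ (j - i - 1)" using ij(1) by (simp add: Suc_diff_Suc flip: power_Suc)
      then have "x ^ (j - i) \<in> Q" using Q_mult'[OF x cl(7)[OF xO]] by simp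
      then have "x ^ (j - i) - (x ^ (j - i) - 1) \<in> Q" using * by (rule Q_diff)
      then show False using Q_1 by simp
    qed
    ultimately have "\<exists>i. \<not> W (b * x ^ i) \<subseteq> Q" by blast
    \<comment> \<open>At the exponent just before the first such \<open>m\<close> the annihilator is
      still inside \<open>Q\<close>, so by maximality it equals \<open>W b\<close>.\<close>
    define m where "m = (LEAST i. \<not> W (b * x ^ i) \<subseteq> Q)"
    have m: "\<not> W (b * x ^ m) \<subseteq> Q"
      using \<open>\<exists>i. \<not> W (b * x ^ i) \<subseteq> Q\<close> unfolding m_def by (rule LeastI_ex)
    then have "m \<noteq> 0" using b(2) by (intro notI) simp
    then obtain k where k: "m = Suc k" by (cases m) auto
    have "W (b * x ^ k) \<subseteq> Q" using not_less_Least[of k "\<lambda>i. \<not> W (b * x ^ i) \<subseteq> Q"] k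
      by (auto simp: m_def)
    then have Wk: "W (b * x ^ k) = W b" by (intro max cl xO)
    \<comment> \<open>Since \<open>u\<close> annihilates \<open>b * x ^ m\<close>, the product
      \<open>u * x\<close> annihilates \<open>b * x ^ k\<close> and hence \<open>b\<close>. As
      \<open>u\<close> is outside \<open>Q\<close>, replacing \<open>b\<close> by
      \<open>b * u\<close> keeps the annihilator inside \<open>Q\<close>; maximality makes it
      \<open>W b\<close> again, and it contains \<open>x\<close>.\<close>
    obtain u where u: "u \<in> W (b * x ^ m)" "u \<notin> Q" using m by blast
    then have uO: "u \<in> \<O> K" unfolding W_iff by blast
    have "u * x \<in> W (b * x ^ k)"
      using u(1) cl(4)[OF uO xO] unfolding W_iff k by (auto simp: mult_ac)
    then have ux: "u * x \<in> W b" using Wk by simp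
    have "W (b * u) \<subseteq> Q"
    proof
      fix z assume z: "z \<in> W (b * u)"
      then have zO: "z \<in> \<O> K" unfolding W_iff by blast
      have "u * z \<in> W b" using z cl(4)[OF uO zO] unfolding W_iff by (auto simp: mult_ac)
      then show "z \<in> Q" using b(2) Q_prime[OF uO zO] u(2) by blast
    qed
    then have "W (b * u) = W b" using max uO by blast
    moreover have "x \<in> W (b * u)" using ux xO unfolding W_iff by (auto simp: mult_ac)
    ultimately show "x \<in> W b" by simp
  qed
  then have "W b = Q" using b(2) by blast
  then show thesis using that[of b] b(1) by (auto simp: W_def)
qed

text \<open>If \<open>\<gamma>\<close> mapped \<open>Q\<close> into itself, all
  \<open>p * \<gamma> ^ n\<close> would be integral and so would \<open>\<gamma>\<close>, giving
  \<open>1\<close> in \<open>Q\<close>. Hence some \<open>t\<close> in \<open>Q\<close> has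
  \<open>\<gamma> * t\<close> integral but outside \<open>Q\<close>; it acts as a local generator of
  \<open>Q\<close>.\<close>

lemma ex_inverse_element:
  obtains \<gamma> t where "\<gamma> \<in> K" "t \<in> Q" "\<gamma> * t \<in> \<O> K" "\<gamma> * t \<notin> Q"
    "\<forall>x\<in>\<O> K. x \<in> Q \<longleftrightarrow> \<gamma> * x \<in> \<O> K"
proof -
  obtain b where b: "b \<in> \<O> K" "\<forall>x\<in>\<O> K. x \<in> Q \<longleftrightarrow> (\<exists>y\<in>\<O> K. b * x = of_nat p * y)"
    by (rule ex_annihilator)
  define \<gamma> where "\<gamma> = b / of_nat p"
  have \<gamma>K: "\<gamma> \<in> K"
    using b(1) number_field_closed[OF K] by (simp add: \<gamma>_def integers_def)
  have \<gamma>: "x \<in> Q \<longleftrightarrow> \<gamma> * x \<in> \<O> K" if "x \<in> \<O> K" for x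
  proof -
    have "b * x = of_nat p * y \<longleftrightarrow> \<gamma> * x = y" for y
      using p_nonzero by (auto simp: \<gamma>_def field_simps)
    then show ?thesis using bspec[OF b(2) that] by simp
  qed
  have "\<exists>t\<in>Q. \<gamma> * t \<notin> Q"
  proof (rule ccontr)
    assume "\<not> (\<exists>t\<in>Q. \<gamma> * t \<notin> Q)"
    then have st: "\<gamma> * t \<in> Q" if "t \<in> Q" for t using that by blast
    have "of_nat p * \<gamma> ^ n \<in> Q" for n
    proof (induction n)
      case (Suc n)
      then show ?case using st[OF Suc] by (simp add: mult_ac)
    qed (simp add: p_mem)
    then have "algebraic_int \<gamma>"
      using algebraic_int_if_bounded_denominator[OF K p_pos] Q_sub by blast
    then have "1 \<in> Q" using \<gamma>[OF cl(2)] \<gamma>K by (simp add: integers_def)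
    then show False using Q_1 by simp
  qed
  then obtain t where "t \<in> Q" "\<gamma> * t \<notin> Q" by blast
  then show thesis using that[of \<gamma> t] \<gamma>K \<gamma> Q_sub by blast
qed

text \<open>Fixed once for the locale, so that all powers of \<open>Q\<close> are measured by the
  same element. It plays the role of the inverse of a uniformizer at \<open>Q\<close>, without
  denominators at other primes.\<close>

definition \<gamma> where
  "\<gamma> = (SOME \<gamma>. \<gamma> \<in> K \<and> (\<exists>t\<in>Q. \<gamma> * t \<in> \<O> K \<and> \<gamma> * t \<notin> Q) \<and>
     (\<forall>x\<in>\<O> K. x \<in> Q \<longleftrightarrow> \<gamma> * x \<in> \<O> K))"

lemma \<gamma>_mem: "\<gamma> \<in> K"
  and ex_\<gamma>_t: "\<exists>t\<in>Q. \<gamma> * t \<in> \<O> K \<and> \<gamma> * t \<notin> Q"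
  and mem_Q_iff: "x \<in> \<O> K \<Longrightarrow> x \<in> Q \<longleftrightarrow> \<gamma> * x \<in> \<O> K"
proof -
  have "\<exists>\<gamma>. \<gamma> \<in> K \<and> (\<exists>t\<in>Q. \<gamma> * t \<in> \<O> K \<and> \<gamma> * t \<notin> Q) \<and>
      (\<forall>x\<in>\<O> K. x \<in> Q \<longleftrightarrow> \<gamma> * x \<in> \<O> K)"
    by (rule ex_inverse_element) auto
  from someI_ex[OF this, folded \<gamma>_def]
  show "\<gamma> \<in> K" "\<exists>t\<in>Q. \<gamma> * t \<in> \<O> K \<and> \<gamma> * t \<notin> Q"
    "x \<in> \<O> K \<Longrightarrow> x \<in> Q \<longleftrightarrow> \<gamma> * x \<in> \<O> K"
    by auto
qed

lemma \<gamma>_notin: "\<gamma> \<notin> \<O> K"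
  using mem_Q_iff[OF cl(2)] Q_1 by simp

section \<open>Powers of \<open>Q\<close> as integrality conditions\<close>

sublocale R: cring "ring_of_integers K"
  by (rule cring_ring_of_integers[OF K])

abbreviation Qpow :: "nat \<Rightarrow> 'a set" where
  "Qpow n \<equiv> Q [^]\<^bsub>ideals_set (ring_of_integers K)\<^esub> n"

lemma Qpow_0: "Qpow 0 = \<O> K"
  by (simp add: ideals_set_def)

lemma Qpow_Suc: "Qpow (Suc n) = ideal_prod (ring_of_integers K) (Qpow n) Q"
  by (simp add: ideals_set_def)

lemma ideal_Qpow: "ideal (Qpow n) (ring_of_integers K)"
proof -
  interpret I: comm_monoid "ideals_set (ring_of_integers K)"
    by (rule R.ideals_set_is_comm_monoid)
  have "Q \<in> carrier (ideals_set (ring_of_integers K))"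
    using ideal_Q by (simp add: ideals_set_def)
  then have "Qpow n \<in> carrier (ideals_set (ring_of_integers K))"
    by (rule I.nat_pow_closed)
  then show ?thesis by (simp add: ideals_set_def)
qed

lemma Qpow_mult: "a \<in> \<O> K \<Longrightarrow> x \<in> Qpow n \<Longrightarrow> a * x \<in> Qpow n"
  using ideal_Qpow unfolding ideal_ring_of_integers_iff[OF K] by blast

lemma Qpow_Suc_subset: "x \<in> Qpow (Suc n) \<Longrightarrow> x \<in> Qpow n"
  using R.ideal_prod_inter[OF ideal_Qpow ideal_Q] unfolding Qpow_Suc by blast

lemma Qpow_imp: "x \<in> Qpow n \<Longrightarrow> x \<in> \<O> K \<and> \<gamma> ^ n * x \<in> \<O> K"
proof (induction n arbitrary: x)
  case 0
  then show ?case by (simp only: Qpow_0) simp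
next
  case (Suc n)
  from Suc.prems show ?case
    unfolding Qpow_Suc
  proof (induction x rule: ideal_prod.induct)
    case (prod i j)
    have "\<gamma> * j \<in> \<O> K" using mem_Q_iff[OF Q_sub] prod by blast
    then have "(\<gamma> ^ n * i) * (\<gamma> * j) \<in> \<O> K" using Suc.IH[OF prod(1)] cl(4) by blast
    moreover have "i * j \<in> \<O> K" using Suc.IH[OF prod(1)] Q_sub[OF prod(2)] cl(4) by blast
    ultimately show ?case by (simp add: mult_ac)
  next
    case (sum s1 s2)
    then show ?case using cl(3) by (simp add: distrib_left)
  qed
qed

text \<open>With \<open>u'\<close> inverse to \<open>u\<close> modulo \<open>Q\<close>, write
  \<open>x = u' * (u * x) + x * (1 - u' * u)\<close>. By induction \<open>x\<close> already lies in
  the previous power, and the factor in \<open>Q\<close> raises the second summand by one.\<close>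

lemma Qpow_cancel:
  assumes "u \<in> \<O> K" "u \<notin> Q" "x \<in> \<O> K" "u * x \<in> Qpow n"
  shows "x \<in> Qpow n"
  using assms(4)
proof (induction n)
  case 0
  then show ?case using assms(3) Qpow_0 by simp
next
  case (Suc n)
  obtain u' where u': "u' \<in> \<O> K" "1 - u' * u \<in> Q"
    using maximal[OF assms(1,2)] .
  have "x * (1 - u' * u) \<in> Qpow (Suc n)"
    unfolding Qpow_Suc using ideal_prod.prod[of x "Qpow n" "1 - u' * u" Q "ring_of_integers K"]
    Suc.IH[OF Qpow_Suc_subset[OF Suc.prems]] u' by simp
  moreover have "u' * (u * x) \<in> Qpow (Suc n)"
    by (rule Qpow_mult[OF u'(1) Suc.prems])
  ultimately have "u' * (u * x) + x * (1 - u' * u) \<in> Qpow (Suc n)"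
    using ideal_Qpow[of "Suc n"] unfolding ideal_ring_of_integers_iff[OF K] by blast
  then show ?case by (simp add: algebra_simps)
qed

text \<open>For the converse of \<open>Qpow_imp\<close>, multiply the integral element
  \<open>\<gamma> ^ n * x\<close> by \<open>t ^ n\<close>, which lies in the \<open>n\<close>-th
  power. The product is \<open>(\<gamma> * t) ^ n * x\<close>, and the factor
  \<open>(\<gamma> * t) ^ n\<close> is outside \<open>Q\<close>, so it cancels.\<close>

lemma mem_Qpow_iff: "x \<in> Qpow n \<longleftrightarrow> x \<in> \<O> K \<and> \<gamma> ^ n * x \<in> \<O> K"
proof
  assume x: "x \<in> \<O> K \<and> \<gamma> ^ n * x \<in> \<O> K"
  obtain t where t: "t \<in> Q" "\<gamma> * t \<in> \<O> K" "\<gamma> * t \<notin> Q" using ex_\<gamma>_t by blast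
  have "t ^ n \<in> Qpow n"
  proof (induction n)
    case 0
    then show ?case using cl(2) Qpow_0 by simp
  next
    case (Suc n)
    then show ?case
      unfolding Qpow_Suc using ideal_prod.prod[of "t ^ n" "Qpow n" t Q "ring_of_integers K"] t
      by (simp add: mult.commute)
  qed
  then have "(\<gamma> ^ n * x) * t ^ n \<in> Qpow n" using x Qpow_mult by blast
  then have "(\<gamma> * t) ^ n * x \<in> Qpow n" by (simp add: power_mult_distrib mult_ac)
  moreover have "(\<gamma> * t) ^ n \<in> \<O> K" "(\<gamma> * t) ^ n \<notin> Q"
    using cl(7) t Q_power by blast+
  ultimately show "x \<in> Qpow n" using Qpow_cancel x by blast
qed (rule Qpow_imp)

lemma Qpow_antimono: "m \<le> n \<Longrightarrow> x \<in> Qpow n \<Longrightarrow> x \<in> Qpow m"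
  by (induction n rule: dec_induct) (use Qpow_Suc_subset in auto)

section \<open>Order, valuation and absolute value at \<open>Q\<close>\<close>

abbreviation "ord \<equiv> ord_integral K Q"

text \<open>An integral \<open>\<gamma> ^ n * x\<close> outside \<open>Q\<close> becomes
  non-integral after one more factor \<open>\<gamma>\<close>, so \<open>n\<close> is the last
  exponent possible.\<close>

lemma ord_eqI:
  assumes "x \<in> \<O> K" "\<gamma> ^ n * x \<in> \<O> K" "\<gamma> ^ n * x \<notin> Q"
  shows "ord x = n"
  unfolding ord_integral_def
proof (rule Greatest_equality)
  show "x \<in> Qpow n" using assms mem_Qpow_iff by blast
  fix m assume m: "x \<in> Qpow m"
  show "m \<le> n"
  proof (rule ccontr)
    assume "\<not> m \<le> n"
    then have "x \<in> Qpow (Suc n)" using Qpow_antimono[OF _ m, of "Suc n"] by simp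
    then have "\<gamma> * (\<gamma> ^ n * x) \<in> \<O> K" using mem_Qpow_iff[of x "Suc n"] by (simp add: mult.assoc)
    then show False using mem_Q_iff[OF assms(2)] assms(3) by simp
  qed
qed

text \<open>If the process never stopped, all \<open>\<gamma> ^ n * x\<close> would be integral. A
  multiple of \<open>x\<close> is a nonzero integer \<open>N\<close>, which would then be a common
  denominator for all powers of \<open>\<gamma>\<close>, making \<open>\<gamma>\<close>
  integral.\<close>

lemma ord_spec:
  assumes "x \<in> \<O> K" "x \<noteq> 0"
  shows "\<gamma> ^ ord x * x \<in> \<O> K" "\<gamma> ^ ord x * x \<notin> Q"
proof -
  have "\<exists>n. \<gamma> ^ n * x \<in> \<O> K \<and> \<gamma> ^ n * x \<notin> Q"
  proof (rule ccontr)
    assume "\<not> ?thesis"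
    then have Q: "\<gamma> ^ n * x \<in> Q" if "\<gamma> ^ n * x \<in> \<O> K" for n using that by blast
    have int: "\<gamma> ^ n * x \<in> \<O> K" for n
    proof (induction n)
      case (Suc n)
      then show ?case using mem_Q_iff[OF Suc] Q[OF Suc] by (simp add: mult.assoc)
    qed (use assms in simp)
    obtain y N where N: "y \<in> \<O> K" "N \<noteq> 0" "x * y = of_int N"
      using integer_divides_int[OF K assms] .
    have "of_int N * \<gamma> ^ n \<in> \<O> K" for n
      using cl(4)[OF int[of n] N(1)] by (simp add: N(3)[symmetric] mult_ac)
    then have "of_int (sgn N) * (of_int N * \<gamma> ^ n) \<in> \<O> K" for n
      using cl(4)[OF cl(8)] by blast
    moreover have "(of_nat (nat \<bar>N\<bar>) :: 'a) = of_int (sgn N) * of_int N"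
      by (metis abs_ge_zero abs_sgn mult.commute of_int_mult of_nat_nat)
    then have "of_int (sgn N) * (of_int N * \<gamma> ^ n) = of_nat (nat \<bar>N\<bar>) * \<gamma> ^ n" for n
      by (simp only: mult.assoc)
    ultimately have "of_nat (nat \<bar>N\<bar>) * \<gamma> ^ n \<in> \<O> K" for n by metis
    then have "algebraic_int \<gamma>"
      using algebraic_int_if_bounded_denominator[OF K, of "nat \<bar>N\<bar>" \<gamma>] N(2) by simp
    then show False using \<gamma>_notin \<gamma>_mem by (simp add: integers_def)
  qed
  then show "\<gamma> ^ ord x * x \<in> \<O> K" "\<gamma> ^ ord x * x \<notin> Q"
    using ord_eqI[OF assms(1)] by blast+
qed

lemma ord_ge_iff:
  assumes "x \<in> \<O> K" "x \<noteq> 0"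
  shows "n \<le> ord x \<longleftrightarrow> x \<in> Qpow n"
proof
  show "x \<in> Qpow n" if "n \<le> ord x"
    using Qpow_antimono[OF that] mem_Qpow_iff ord_spec[OF assms] assms(1) by blast
next
  assume x: "x \<in> Qpow n"
  show "n \<le> ord x"
  proof (rule ccontr)
    assume "\<not> n \<le> ord x"
    then have "x \<in> Qpow (Suc (ord x))" by (intro Qpow_antimono[OF _ x]) simp
    then have "\<gamma> * (\<gamma> ^ ord x * x) \<in> \<O> K"
      using mem_Qpow_iff[of x "Suc (ord x)"] by (simp add: mult.assoc)
    then show False using mem_Q_iff ord_spec[OF assms] by blast
  qed
qed

text \<open>The product of two integral elements outside the prime \<open>Q\<close> is outside
  \<open>Q\<close>, so the two stopping exponents add up.\<close>

lemma ord_mult: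
  assumes "x \<in> \<O> K" "x \<noteq> 0" "y \<in> \<O> K" "y \<noteq> 0"
  shows "ord (x * y) = ord x + ord y"
proof (rule ord_eqI)
  show "x * y \<in> \<O> K" by (intro cl assms)
  have eq: "\<gamma> ^ (ord x + ord y) * (x * y) = (\<gamma> ^ ord x * x) * (\<gamma> ^ ord y * y)"
    by (simp add: power_add mult_ac)
  show "\<gamma> ^ (ord x + ord y) * (x * y) \<in> \<O> K"
    unfolding eq by (intro cl ord_spec assms)
  show "\<gamma> ^ (ord x + ord y) * (x * y) \<notin> Q"
    unfolding eq using Q_prime ord_spec[OF assms(1,2)] ord_spec[OF assms(3,4)] by blast
qed

text \<open>Shows that the definite description is well defined: two fractions for the same element
  have equal cross products, and \<open>ord_mult\<close> compares them.\<close>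

lemma ord_prime_divide:
  assumes "a \<in> \<O> K" "a \<noteq> 0" "b \<in> \<O> K" "b \<noteq> 0"
  shows "ord_prime K Q (a / b) = int (ord a) - int (ord b)"
  unfolding ord_prime_def
proof (rule the_equality)
  show "\<exists>a' b'. a' \<in> carrier (ring_of_integers K) - {0} \<and> b' \<in> carrier (ring_of_integers K) - {0} \<and>
      a / b = a' / b' \<and> int (ord a) - int (ord b) = int (ord a') - int (ord b')"
    using assms by auto
next
  fix k
  assume "\<exists>a' b'. a' \<in> carrier (ring_of_integers K) - {0} \<and> b' \<in> carrier (ring_of_integers K) - {0} \<and>
      a / b = a' / b' \<and> k = int (ord a') - int (ord b')"
  then obtain a' b' where ab: "a' \<in> \<O> K" "a' \<noteq> 0" "b' \<in> \<O> K" "b' \<noteq> 0"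
    "a / b = a' / b'" "k = int (ord a') - int (ord b')"
    by auto
  have "a * b' = a' * b" using ab assms by (simp add: field_simps)
  then have "ord a + ord b' = ord a' + ord b"
    using ord_mult[of a b'] ord_mult[of a' b] ab assms by simp
  then show "k = int (ord a) - int (ord b)" using ab by simp
qed

lemma ord_prime_integer: "a \<in> \<O> K \<Longrightarrow> a \<noteq> 0 \<Longrightarrow> ord_prime K Q a = int (ord a)"
  using ord_prime_divide[of a 1] cl(2) ord_eqI[of 1 0] Q_1 by simp

lemma valuation_minus:
  assumes "x \<in> K" "x \<noteq> 0"
  shows "valuation K Q (- x) = valuation K Q x"
proof -
  obtain a N where a: "a \<in> \<O> K" "N \<noteq> 0" "x = a / of_int N"
    using number_field_fraction[OF K assms(1)] .
  then have nz: "a \<noteq> 0" using assms by auto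
  have "ord (- a) = ord a"
    by (rule ord_eqI) (use ord_spec[OF a(1) nz] cl(5) a(1) Q_minus in force)+
  then have "ord_prime K Q (- a / of_int N) = ord_prime K Q (a / of_int N)"
    using ord_prime_divide[of a "of_int N"] ord_prime_divide[of "- a" "of_int N"] a nz cl(5)[of a]
      cl(8)[of N] by simp
  then show ?thesis unfolding valuation_def a(3) by simp
qed

lemma ord_p_pos: "ord (of_nat p) > 0"
proof -
  have "of_nat p \<in> Qpow 1"
    unfolding mem_Qpow_iff using cl(9) p_mem mem_Q_iff[OF cl(9)] by simp
  then show ?thesis using ord_ge_iff[of "of_nat p" 1] cl(9) p_nonzero by simp
qed

lemma ord_p_power: "ord (of_nat p ^ k) = k * ord (of_nat p)"
proof (induction k)
  case 0
  show ?case using ord_eqI[of 1 0] cl(2) Q_1 by simp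
next
  case (Suc k)
  then show ?case using ord_mult[OF cl(9) p_nonzero cl(7)[OF cl(9)], of p k] p_nonzero by simp
qed

lemma valuation_p_power: "valuation K Q (of_nat p ^ k) = of_nat k"
  unfolding valuation_def
  using ord_prime_integer[OF cl(7)[OF cl(9)], of p k] ord_prime_integer[OF cl(9) p_nonzero]
    p_nonzero ord_p_pos
  by (simp add: ord_p_power)

text \<open>Over a common denominator the claim is that a power of \<open>Q\<close> is closed under
  subtraction. The normalizing divisor is positive, so it preserves the inequality.\<close>

lemma valuation_diff:
  assumes "x \<in> K" "y \<in> K" "x \<noteq> 0" "y \<noteq> 0" "x \<noteq> y"
  shows "min (valuation K Q x) (valuation K Q y) \<le> valuation K Q (x - y)"
proof -
  obtain a M where a: "a \<in> \<O> K" "M \<noteq> 0" "x = a / of_int M"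
    using number_field_fraction[OF K assms(1)] .
  obtain b N where b: "b \<in> \<O> K" "N \<noteq> 0" "y = b / of_int N"
    using number_field_fraction[OF K assms(2)] .
  define d :: 'a where "d = of_int (M * N)"
  define a' where "a' = a * of_int N"
  define b' where "b' = b * of_int M"
  have d: "d \<in> \<O> K" "d \<noteq> 0" using a b cl(8) by (auto simp: d_def simp del: of_int_mult)
  have a': "a' \<in> \<O> K" and b': "b' \<in> \<O> K" and ab': "a' - b' \<in> \<O> K"
    unfolding a'_def b'_def by (intro cl a b)+
  have eq: "x = a' / d" "y = b' / d" "x - y = (a' - b') / d"
    using a b by (auto simp: a'_def b'_def d_def field_simps)
  have nz: "a' \<noteq> 0" "b' \<noteq> 0" "a' - b' \<noteq> 0" using eq assms by auto
  define n where "n = min (ord a') (ord b')"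
  have "a' \<in> Qpow n" "b' \<in> Qpow n"
    using ord_ge_iff[OF a' nz(1), of n] ord_ge_iff[OF b' nz(2), of n] by (auto simp: n_def)
  then have "a' - b' \<in> Qpow n"
    using ab' cl(6)[of "\<gamma> ^ n * a'" "\<gamma> ^ n * b'"] unfolding mem_Qpow_iff by (simp add: algebra_simps)
  then have "n \<le> ord (a' - b')" using ord_ge_iff[OF ab' nz(3)] by simp
  then have "min (ord_prime K Q x) (ord_prime K Q y) \<le> ord_prime K Q (x - y)"
    unfolding eq(3) unfolding eq(1,2) using ord_prime_divide[OF a' nz(1) d]
      ord_prime_divide[OF b' nz(2) d] ord_prime_divide[OF ab' nz(3) d]
    by (auto simp: n_def min_def split: if_splits)
  then have "of_int (min (ord_prime K Q x) (ord_prime K Q y)) \<le> (of_int (ord_prime K Q (x - y)) :: rat)"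
    by (simp only: of_int_le_iff)
  moreover have "(of_int (ord_prime K Q (of_nat p)) :: rat) > 0"
    using ord_prime_integer[OF cl(9) p_nonzero] ord_p_pos by simp
  ultimately show ?thesis
    unfolding valuation_def by (auto simp: min_def divide_le_cancel split: if_splits)
qed

lemma prime_abs_diff:
  assumes c: "0 < c" "c < 1" and "x \<in> K" "y \<in> K"
  shows "prime_abs c K Q (x - y) \<le> max (prime_abs c K Q x) (prime_abs c K Q y)"
proof -
  \<comment> \<open>Zero arguments are separated because \<open>valuation\<close> carries no meaning
    there; in the last case \<open>c < 1\<close> turns the minimum of valuations into a maximum of
    absolute values.\<close>
  consider "x = y" | "y = 0" | "x = 0" "y \<noteq> 0" | "x \<noteq> 0" "y \<noteq> 0" "x \<noteq> y" by blast
  then show ?thesis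
  proof cases
    case 3
    then show ?thesis using valuation_minus[OF assms(4)] by (simp add: prime_abs_def)
  next
    case 4
    then have "min (valuation K Q x) (valuation K Q y) \<le> valuation K Q (x - y)"
      using valuation_diff assms by blast
    then have "(of_rat (min (valuation K Q x) (valuation K Q y)) :: real)
        \<le> of_rat (valuation K Q (x - y))"
      by (simp only: of_rat_less_eq)
    then have "c powr of_rat (valuation K Q (x - y))
        \<le> c powr of_rat (min (valuation K Q x) (valuation K Q y))"
      using c by (intro powr_mono') auto
    also have "\<dots> \<le> max (prime_abs c K Q x) (prime_abs c K Q y)"
      using 4 by (simp add: min_def prime_abs_def)
    finally show ?thesis using 4 by (simp add: prime_abs_def)
  qed (auto simp: prime_abs_def max_def)
qed

end

section \<open>The arithmetic derivative\<close>

context number_field_prime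
begin

text \<open>A maximal element among the finitely many proper ideals that contain \<open>p\<close>,
  chosen above the extension of \<open>Q\<close>, is prime.\<close>

lemma ex_prime_above:
  assumes L: "number_field L" "K \<subseteq> L"
  shows "\<exists>M\<in>nonzero_primes L. M \<inter> \<O> K = Q"
proof -
  note Lcl = integers_closed[OF L(1)]
  have OKL: "\<O> K \<subseteq> \<O> L" using L(2) by (auto simp: integers_def)
  have idL: "ideal J (ring_of_integers L) \<longleftrightarrow> J \<subseteq> \<O> L \<and> 0 \<in> J \<and>
    (\<forall>x\<in>J. \<forall>y\<in>J. x + y \<in> J) \<and> (\<forall>a\<in>\<O> L. \<forall>x\<in>J. a * x \<in> J)" for J
    by (rule ideal_ring_of_integers_iff[OF L(1)])
  \<comment> \<open>The extension of \<open>Q\<close> to the larger ring is proper because \<open>\<gamma>\<close> is not integral.\<close>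
  define J where "J = {y \<in> \<O> L. \<gamma> * y \<in> \<O> L}"
  have QJ: "Q \<subseteq> J"
    using mem_Q_iff Q_sub OKL unfolding J_def by blast
  have J: "ideal J (ring_of_integers L)"
    unfolding idL
  proof (intro conjI ballI)
    show "J \<subseteq> \<O> L" by (auto simp: J_def)
    show "0 \<in> J" using Lcl(1) by (simp add: J_def)
    show "x + y \<in> J" if "x \<in> J" "y \<in> J" for x y
      using that Lcl(3) by (simp add: J_def distrib_left)
    show "a * x \<in> J" if "a \<in> \<O> L" "x \<in> J" for a x
      using that Lcl(4)[of a x] Lcl(4)[of a "\<gamma> * x"] by (simp add: J_def mult.left_commute)
  qed
  have J1: "1 \<notin> J"
    using \<gamma>_notin \<gamma>_mem by (auto simp: J_def integers_def)
  define \<J> where "\<J> = {J. ideal J (ring_of_integers L) \<and> of_nat p \<in> J \<and> 1 \<notin> J}"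
  have fin: "finite \<J>"
    by (rule finite_subset[OF _ finite_ideals_containing[OF L(1) p_pos]]) (auto simp: \<J>_def)
  have "J \<in> \<J>" using J J1 QJ p_mem by (auto simp: \<J>_def)
  from finite_has_maximal2[OF fin this] obtain M where
    M: "M \<in> \<J>" "J \<subseteq> M" "\<forall>M'\<in>\<J>. M \<subseteq> M' \<longrightarrow> M = M'"
    by (elim bexE conjE)
  then have Mid: "ideal M (ring_of_integers L)" and pM: "of_nat p \<in> M" and M1: "1 \<notin> M"
    by (auto simp: \<J>_def)
  note Mid' = Mid[unfolded idL]
  have prime: "a \<in> M \<or> b \<in> M" if ab: "a \<in> \<O> L" "b \<in> \<O> L" "a * b \<in> M" for a b
  proof (rule ccontr)
    assume no: "\<not> (a \<in> M \<or> b \<in> M)"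
    \<comment> \<open>The ideal generated by \<open>M\<close> and \<open>a\<close>. It is strictly
      larger than \<open>M\<close>, so it contains \<open>1\<close>; multiplying that representation
      of \<open>1\<close> by \<open>b\<close> puts \<open>b\<close> into \<open>M\<close>.\<close>
    define N where "N = {m + r * a | m r. m \<in> M \<and> r \<in> \<O> L}"
    have N: "m + r * a \<in> N" if "m \<in> M" "r \<in> \<O> L" for m r using that by (auto simp: N_def)
    have MN: "M \<subseteq> N" using N[OF _ Lcl(1)] by force
    have aN: "a \<in> N" using N[OF _ Lcl(2), of 0] Mid' by simp
    have "ideal N (ring_of_integers L)"
      unfolding idL
    proof (intro conjI ballI)
      show "N \<subseteq> \<O> L"
      proof
        fix x assume "x \<in> N"
        then obtain m r where "x = m + r * a" "m \<in> M" "r \<in> \<O> L" by (auto simp: N_def)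
        then show "x \<in> \<O> L" using Mid' ab(1) Lcl(3,4) by blast
      qed
      show "0 \<in> N" using MN Mid' by blast
      show "x + y \<in> N" if xy: "x \<in> N" "y \<in> N" for x y
      proof -
        obtain m r m' r' where "x = m + r * a" "m \<in> M" "r \<in> \<O> L" "y = m' + r' * a" "m' \<in> M" "r' \<in> \<O> L"
          using xy by (auto simp: N_def)
        then show ?thesis using N[of "m + m'" "r + r'"] Mid' Lcl(3)
          by (simp add: algebra_simps)
      qed
      show "c * x \<in> N" if cx: "c \<in> \<O> L" "x \<in> N" for c x
      proof -
        obtain m r where "x = m + r * a" "m \<in> M" "r \<in> \<O> L"
          using cx by (auto simp: N_def)
        then show ?thesis using N[of "c * m" "c * r"] Mid' Lcl(4) cx(1)
          by (simp add: algebra_simps)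
      qed
    qed
    moreover have "M \<noteq> N" using aN no by blast
    ultimately have "N \<notin> \<J>" "ideal N (ring_of_integers L)" using M(3) MN by auto
    then have "1 \<in> N" using MN pM by (auto simp: \<J>_def)
    then obtain m r where mr: "1 = m + r * a" "m \<in> M" "r \<in> \<O> L" by (auto simp: N_def)
    have "b * m + r * (a * b) \<in> M" using Mid' mr(2,3) ab by blast
    also have "b * m + r * (a * b) = b * (m + r * a)" by (simp add: algebra_simps)
    finally show False using no mr(1) by simp
  qed
  have "primeideal M (ring_of_integers L)"
  proof (rule primeidealI[OF Mid cring_ring_of_integers[OF L(1)]])
    show "carrier (ring_of_integers L) \<noteq> M" using M1 Lcl(2) by auto
  qed (use prime in auto)
  moreover have "M \<noteq> {0}" using pM p_nonzero by auto
  moreover have "M \<inter> \<O> K = Q"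
  proof
    show "Q \<subseteq> M \<inter> \<O> K" using QJ M(2) Q_sub by blast
    show "M \<inter> \<O> K \<subseteq> Q"
    \<comment> \<open>An \<open>x\<close> outside \<open>Q\<close> is invertible modulo
      \<open>Q\<close>, and \<open>Q\<close> is contained in \<open>M\<close>; so \<open>x\<close>
      in \<open>M\<close> would give \<open>1\<close> in \<open>M\<close>.\<close>
    proof (rule subsetI, rule ccontr)
      fix x assume x: "x \<in> M \<inter> \<O> K" "x \<notin> Q"
      then obtain x' where x': "x' \<in> \<O> K" "1 - x' * x \<in> Q" using maximal by blast
      then have "1 - x' * x \<in> M" using QJ M(2) by blast
      moreover have "x' * x \<in> M" using Mid' x x'(1) OKL by blast
      ultimately have "(1 - x' * x) + x' * x \<in> M" using Mid' by blast
      then show False using M1 by simp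
    qed
  qed
  ultimately show ?thesis by (auto simp: nonzero_primes_def)
qed

end

text \<open>All primes of \<open>L\<close> above \<open>P\<close> lie over the same \<open>p\<close>
  and, by the normalization, have the same valuation at \<open>p ^ k\<close>. The sum in the
  derivative is therefore a count.\<close>

lemma arith_deriv_prime_power:
  fixes K :: "'a::{alg_closed_field, field_char_0} set"
  assumes P: "number_field_prime K P"
  shows "\<exists>C. C \<noteq> 0 \<and> (\<forall>k>0. arith_deriv K {P} (of_nat (prime_below P) ^ k)
    = of_nat (prime_below P) ^ k * of_rat (of_nat k * C))"
proof -
  interpret P: number_field_prime K P by (rule P)
  define L where "L = galois_extension_of K"
  have "K \<subseteq> L \<and> galois_over_rat L"
    unfolding L_def galois_extension_of_def by (rule someI_ex[OF ex_galois_extension[OF P.K]])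
  then have KL: "K \<subseteq> L" and L: "number_field L" by (auto simp: galois_over_rat_def)
  define p where "p = prime_below P"
  define T where "T = primes_lying_over L K {P}"
  have T: "number_field_prime L Q" "P \<subseteq> Q" if "Q \<in> T" for Q
    using that L by (auto simp: T_def primes_lying_over_def nonzero_primes_def intro: number_field_prime.intro)
  have below: "prime_below Q = p" if Q: "Q \<in> T" for Q
  proof -
    interpret Q: number_field_prime L Q by (rule T(1)[OF Q])
    have "of_int (int p) \<in> Q" using T(2)[OF Q] P.p_mem by (auto simp: p_def)
    then have "prime_below Q dvd p" using Q.of_int_mem_Q[of "int p"] by simp
    then show ?thesis using P.prime_p Q.prime_p primes_dvd_imp_eq by (auto simp: p_def)
  qed
  have lies: "lies_over_rat_prime Q p" if "Q \<in> T" for Q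
    using number_field_prime.lies_over_prime_below[OF T(1)[OF that]] below[OF that] by simp
  define S where "S = {Q \<in> nonzero_primes L. lies_over_rat_prime Q p}"
  have "of_nat p \<in> Q" if "lies_over_rat_prime Q p" for Q :: "'a set"
    using that unfolding lies_over_rat_prime_def by (metis (mono_tags) dvd_refl mem_Collect_eq of_int_of_nat_eq)
  then have "S \<subseteq> {J. ideal J (ring_of_integers L) \<and> of_nat p \<in> J}"
    by (auto simp: S_def nonzero_primes_def intro: primeideal.axioms(1))
  then have finS: "finite S"
    using finite_ideals_containing[OF L P.p_pos] unfolding p_def[symmetric] by (rule finite_subset)
  have TS: "T \<subseteq> S" using lies by (auto simp: S_def T_def primes_lying_over_def)
  have "T \<noteq> {}"
    using P.ex_prime_above[OF L KL] by (auto simp: T_def primes_lying_over_def)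
  then have cards: "card T > 0" "card S > 0"
    using finS TS by (auto simp: card_gt_0_iff intro: finite_subset)
  \<comment> \<open>Each of the \<open>card T\<close> primes above \<open>P\<close> contributes
    \<open>k / (p * g)\<close>, and \<open>g\<close> is \<open>card S\<close>.\<close>
  define C :: rat where "C = of_nat (card T) / (of_nat p * of_nat (card S))"
  have "C \<noteq> 0" using cards P.p_pos by (simp add: C_def p_def)
  moreover have "arith_deriv K {P} (of_nat p ^ k) = of_nat p ^ k * of_rat (of_nat k * C)" if k: "k > 0" for k
  proof -
    have val: "valuation L Q (of_nat p ^ k) = of_nat k" if Q: "Q \<in> T" for Q
      using number_field_prime.valuation_p_power[OF T(1)[OF Q], of k] below[OF Q] by simp
    \<comment> \<open>For \<open>k > 0\<close> no valuation on \<open>T\<close> vanishes, so the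
      restricted index set is all of \<open>T\<close>.\<close>
    have "(\<Sum>Q | Q \<in> T \<and> valuation L Q (of_nat p ^ k) \<noteq> 0.
        valuation L Q (of_nat p ^ k) / (of_nat (prime_below Q) * of_nat (num_primes_over (prime_below Q) L)))
      = (\<Sum>Q\<in>T. of_nat k / (of_nat p * of_nat (card S)))"
      by (intro sum.cong) (use val k below in \<open>auto simp: num_primes_over_def S_def\<close>)
    also have "\<dots> = of_nat k * C" by (simp add: C_def)
    finally show ?thesis
      using P.p_nonzero unfolding arith_deriv_def arith_deriv_galois_def L_def[symmetric] T_def[symmetric]
      by (simp add: p_def)
  qed
  ultimately show ?thesis unfolding p_def by blast
qed

theorem theorem5p4:
  fixes K :: "'a::{alg_closed_field, field_char_0} set" and P :: "'a set" and c :: real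
  assumes "number_field K"
    and "primeideal P (ring_of_integers K)" and "P \<noteq> {0}"
    and "0 < c" and "c < 1"
  shows "\<not> strictly_differentiable_at K (prime_abs c K P) (arith_deriv K {P}) 0"
proof
  assume "strictly_differentiable_at K (prime_abs c K P) (arith_deriv K {P}) 0"
  then obtain l where l: "l \<in> K" and lim: "\<And>\<epsilon>. \<epsilon> > 0 \<Longrightarrow> \<exists>\<delta>>0. \<forall>u\<in>K. \<forall>v\<in>K.
      u \<noteq> v \<and> prime_abs c K P (u - 0) < \<delta> \<and> prime_abs c K P (v - 0) < \<delta> \<longrightarrow>
      prime_abs c K P ((arith_deriv K {P} u - arith_deriv K {P} v) / (u - v) - l) < \<epsilon>"
    unfolding strictly_differentiable_at_def by blast
  have P: "number_field_prime K P" using assms(1-3) by (rule number_field_prime.intro)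
  interpret number_field_prime K P by (rule P)
  note Kcl = number_field_closed[OF assms(1)]
  obtain C where C: "C \<noteq> 0"
    "\<And>k. k > 0 \<Longrightarrow> arith_deriv K {P} (of_nat p ^ k) = of_nat p ^ k * of_rat (of_nat k * C)"
    using arith_deriv_prime_power[OF P] by blast
  \<comment> \<open>The absolute value of the gap between difference quotients at consecutive
    exponents.\<close>
  define \<epsilon> where "\<epsilon> = prime_abs c K P (of_rat C)"
  have "\<epsilon> > 0" using C(1) assms(4) by (simp add: \<epsilon>_def prime_abs_def)
  then obtain \<delta> where \<delta>: "\<delta> > 0" "\<And>u v. u \<in> K \<Longrightarrow> v \<in> K \<Longrightarrow> u \<noteq> v \<Longrightarrow>
      prime_abs c K P u < \<delta> \<Longrightarrow> prime_abs c K P v < \<delta> \<Longrightarrow>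
      prime_abs c K P ((arith_deriv K {P} u - arith_deriv K {P} v) / (u - v) - l) < \<epsilon>"
    using lim[of \<epsilon>] by auto
  obtain n where n: "c ^ n < \<delta>" using real_arch_pow_inv[OF \<delta>(1) assms(5)] by blast
  define x where "x k = of_rat (of_nat k * C) - l" for k
  have close: "prime_abs c K P (x k) < \<epsilon>" if k: "k > n" for k
  proof -
    have "prime_abs c K P (of_nat p ^ k) = c ^ k"
      using p_nonzero assms(4) by (simp add: prime_abs_def valuation_p_power powr_realpow)
    also have "\<dots> \<le> c ^ n" using assms(4,5) k by (intro power_decreasing) auto
    finally have "prime_abs c K P (of_nat p ^ k) < \<delta>" using n by simp
    \<comment> \<open>The tested pair is \<open>(p ^ k, 0)\<close>. The derivative is
      \<open>0\<close> at \<open>0\<close> by definition, so the quotient is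
      \<open>k * C\<close>.\<close>
    then have "prime_abs c K P ((arith_deriv K {P} (of_nat p ^ k) - arith_deriv K {P} 0)
        / (of_nat p ^ k - 0) - l) < \<epsilon>"
      using \<delta> p_nonzero by (intro \<delta>(2)) (auto simp: prime_abs_def intro: Kcl)
    moreover have "arith_deriv K {P} 0 = 0"
      by (simp add: arith_deriv_def arith_deriv_galois_def)
    ultimately show ?thesis using C(2)[of k] k p_nonzero by (simp add: x_def)
  qed
  have x: "x k \<in> K" for k unfolding x_def by (intro Kcl l)
  \<comment> \<open>The unknown limit \<open>l\<close> cancels between two consecutive errors; both
    indices exceed \<open>n\<close>, as \<open>close\<close> requires.\<close>
  have "of_nat (Suc (Suc n)) * C = of_nat (Suc n) * C + C" by (simp add: algebra_simps)
  then have "x (Suc (Suc n)) - x (Suc n) = of_rat C"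
    by (simp only: x_def of_rat_add) simp
  then have "\<epsilon> \<le> max (prime_abs c K P (x (Suc (Suc n)))) (prime_abs c K P (x (Suc n)))"
    using prime_abs_diff[OF assms(4,5) x x] unfolding \<epsilon>_def by metis
  also have "\<dots> < \<epsilon>" using close[of "Suc (Suc n)"] close[of "Suc n"] by simp
  finally show False by simp
qed

end
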